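(* Let $k\ge 1$ and $H_{k-1}=\sum_{j=1}^{k-1}\frac1j$ (with $H_0=0$). Let $\mathcal{X}\subseteq\mathbb{R}^d$ be a finite point set, let $\mathcal{U}\subseteq\mathbb{R}^d$ be a set of $k$ distinct centers, and let $\pi:\mathcal{X}\to\mathcal{U}$ be any assignment (a reference $k$-medians clustering). Then the Random Thresholds algorithm outputs a (random) threshold tree $T$ separating $\mathcal{U}$ such that $$\mathbb{E}[\operatorname{cost}_1(T)]\le (1+H_{k-1})\cdot \operatorname{cost}_1(\pi,\mathcal{U}).$$ Consequently, the price of explainability for $k$-medians is at most $1+H_{k-1}$.
   Context: For $q\ge1$, $\operatorname{cost}_q(\pi,\mathcal{U})=\sum_{x\in\mathcal{X}}\|x-\pi(x)\|_q^q$. A threshold cut $(i,\theta)$ ($i\in[d]$, $\theta\in\mathbb{R}$) is the hyperplane $x_i=\theta$. A threshold tree is a rooted binary tree where each internal node $u$ carries a threshold cut $(i_u,\theta_u)$; the root region is $B_r=\mathbb{R}^d$, and the left/right children of $u$ have regions $B_u\cap\{x: x_{i_u}\le\theta_u\}$ and $B_u\cap\{x:x_{i_u}>\theta_u\}$. A threshold tree separates $\mathcal{U}$ if every leaf region contains exactly one center of $\mathcal{U}$; it then induces $\pi_T:\mathcal{X}\to\mathcal{U}$ mapping each point to the unique center in its leaf region, and $\operatorname{cost}_q(T)=\sum_{x\in\mathcal{X}}\|x-\pi_T(x)\|_q^q$. An explainable clustering with $k$ clusters is the partition of $\mathcal{X}$ induced by the leaves of a threshold tree with $k$ leaves; its $k$-medians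 cost is the sum over clusters $C$ of $\min_{c\in\mathbb{R}^d}\sum_{x\in C}\|x-c\|_1$. The price of explainability for $k$-medians is the supremum, over finite point sets $\mathcal{X}$, of the ratio between the minimum $k$-medians cost of an explainable clustering of $\mathcal{X}$ with $k$ clusters and the optimal (unconstrained) $k$-medians cost of $\mathcal{X}$. Random Thresholds algorithm: fix $a<b$ with $\mathcal{X}\cup\mathcal{U}\subseteq[a,b]^d$. Start with the one-node tree (root region $\mathbb{R}^d$). While the leaves do not separate $\mathcal{U}$, pick $i\in[d]$ and $\theta\in[a,b]$ independently and uniformly at random; for every leaf $u$ such that the cut $(i,\theta)$ separates at least one pair of centers of $\mathcal{U}$ lying in $B_u$, split $u$ with this cut. *)

theory Defs
  imports "HOL-Probability.Probability" "HOL-Analysis.Harmonic_Numbers"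
begin

definition l1dist :: "real^'d \<Rightarrow> real^'d \<Rightarrow> real" where
  "l1dist x y = (\<Sum>i\<in>UNIV. \<bar>x$i - y$i\<bar>)"

definition cost1 :: "(real^'d) set \<Rightarrow> (real^'d \<Rightarrow> real^'d) \<Rightarrow> real" where
  "cost1 X \<pi> = (\<Sum>x\<in>X. l1dist x (\<pi> x))"

datatype 'd ttree = Leaf | Node 'd real "'d ttree" "'d ttree"

fun leaf_regions :: "'d::finite ttree \<Rightarrow> (real^'d) set \<Rightarrow> (real^'d) set list" where
  "leaf_regions Leaf B = [B]"
| "leaf_regions (Node i \<theta> l r) B =
     leaf_regions l (B \<inter> {x. x$i \<le> \<theta>}) @ leaf_regions r (B \<inter> {x. x$i > \<theta>})"

definition num_leaves :: "'d::finite ttree \<Rightarrow> nat" where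
  "num_leaves T = length (leaf_regions T UNIV)"

fun region_of :: "'d::finite ttree \<Rightarrow> (real^'d) set \<Rightarrow> real^'d \<Rightarrow> (real^'d) set" where
  "region_of Leaf B x = B"
| "region_of (Node i \<theta> l r) B x =
     (if x$i \<le> \<theta> then region_of l (B \<inter> {y. y$i \<le> \<theta>}) x
      else region_of r (B \<inter> {y. y$i > \<theta>}) x)"

definition separates :: "'d::finite ttree \<Rightarrow> (real^'d) set \<Rightarrow> bool" where
  "separates T U \<longleftrightarrow> (\<forall>B\<in>set (leaf_regions T UNIV). card (B \<inter> U) = 1)"

definition tree_assign :: "'d::finite ttree \<Rightarrow> (real^'d) set \<Rightarrow> real^'d \<Rightarrow> real^'d" where
  "tree_assign T U x = (THE c. c \<in> U \<and> c \<in> region_of T UNIV x)"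

definition tree_cost1 :: "(real^'d) set \<Rightarrow> (real^'d) set \<Rightarrow> 'd::finite ttree \<Rightarrow> real" where
  "tree_cost1 X U T = cost1 X (tree_assign T U)"

definition cut_separates_pair :: "(real^'d) set \<Rightarrow> (real^'d) set \<Rightarrow> 'd::finite \<times> real \<Rightarrow> bool" where
  "cut_separates_pair U B c \<longleftrightarrow>
     (\<exists>u\<in>U \<inter> B. \<exists>v\<in>U \<inter> B. u$(fst c) \<le> snd c \<and> v$(fst c) > snd c)"

fun refine :: "(real^'d::finite) set \<Rightarrow> 'd \<times> real \<Rightarrow> (real^'d) set \<Rightarrow> 'd ttree \<Rightarrow> 'd ttree" where
  "refine U c B Leaf =
     (if cut_separates_pair U B c then Node (fst c) (snd c) Leaf Leaf else Leaf)"
| "refine U c B (Node i \<theta> l r) =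
     Node i \<theta> (refine U c (B \<inter> {x. x$i \<le> \<theta>}) l) (refine U c (B \<inter> {x. x$i > \<theta>}) r)"

fun rt_tree :: "(real^'d) set \<Rightarrow> (nat \<Rightarrow> 'd \<times> real) \<Rightarrow> nat \<Rightarrow> 'd ttree" where
  "rt_tree U w 0 = Leaf"
| "rt_tree U w (Suc n) = refine U (w n) UNIV (rt_tree U w n)"

text \<open>Output of the algorithm: the tree at the first time the leaves separate U
  (the loop stops then).  On the (null) event that this never happens, Leaf is returned.\<close>
definition rt_output :: "(real^'d) set \<Rightarrow> (nat \<Rightarrow> 'd \<times> real) \<Rightarrow> 'd ttree" where
  "rt_output U w =
     (if \<exists>n. separates (rt_tree U w n) U
      then rt_tree U w (LEAST n. separates (rt_tree U w n) U) else Leaf)"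

definition cut_measure :: "real \<Rightarrow> real \<Rightarrow> ('d::finite \<times> real) measure" where
  "cut_measure a b = measure_pmf (pmf_of_set (UNIV :: 'd set)) \<Otimes>\<^sub>M uniform_measure lborel {a..b}"

definition cut_seq_space :: "real \<Rightarrow> real \<Rightarrow> (nat \<Rightarrow> 'd::finite \<times> real) measure" where
  "cut_seq_space a b = (\<Pi>\<^sub>M n\<in>(UNIV :: nat set). cut_measure a b)"

definition cluster_cost :: "(real^'d) set \<Rightarrow> real" where
  "cluster_cost C = (INF c. \<Sum>x\<in>C. l1dist x c)"

definition expl_cost :: "(real^'d) set \<Rightarrow> 'd::finite ttree \<Rightarrow> real" where
  "expl_cost X T = (\<Sum>B\<leftarrow>leaf_regions T UNIV. cluster_cost (X \<inter> B))"

definition expl_opt :: "nat \<Rightarrow> (real^'d) set \<Rightarrow> real" where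
  "expl_opt k X = (INF T \<in> {T. num_leaves T = k}. expl_cost X T)"

definition kmed_opt :: "nat \<Rightarrow> (real^'d) set \<Rightarrow> real" where
  "kmed_opt k X = (INF U \<in> {U. finite U \<and> card U = k}. \<Sum>x\<in>X. Min (l1dist x ` U))"

end

theory Submission
  imports Defs
begin

text \<open>
  Fix a point \<open>x\<close> with reference centre \<open>u\<close>.  A random cut acts on the leaf of \<open>x\<close> only through the
  set \<open>S\<close> of centres that it separates from \<open>x\<close>: the set \<open>A\<close> of centres still in that leaf becomes
  \<open>A - S\<close> unless \<open>S\<close> misses or contains \<open>A\<close>.  If \<open>\<mu> S\<close> is the probability of \<open>S\<close>, the distance from
  \<open>x\<close> to \<open>v\<close> is proportional to the sum of \<open>\<mu> S\<close> over all \<open>S\<close> containing \<open>v\<close>.  So it suffices to find a potential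
  \<open>\<Phi>\<close> that is superharmonic for this process, dominates the distance on singletons, and starts at
  no more than \<open>1 + harm (k - 1)\<close> times the distance to \<open>u\<close>.

  Give every \<open>S\<close> not containing \<open>u\<close> an independent exponential clock of rate \<open>\<mu> S\<close>, let \<open>T v\<close> be the first
  ring among the sets containing \<open>v\<close>, and \<open>a v\<close> its rate, so that \<open>a v * T v\<close> is standard exponential.
  With \<open>h A\<close> the mean of the maximum of \<open>a v * T v\<close> over \<open>A\<close>, and \<open>\<eta> A\<close> the sum of
  \<open>\<mu> S * (h A - h (A - S))\<close> over those \<open>S\<close>, the potential is
  \<open>d u + B (A - {u})\<close> while \<open>u\<close> survives and \<open>d u + \<eta> A + B A\<close> afterwards, where
  \<open>d u\<close> is the sum of \<open>\<mu> S\<close>, and \<open>B A\<close> the sum of \<open>\<mu> S * h (A - S)\<close>, over the sets \<open>S\<close> containing \<open>u\<close>.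
  Superharmonicity reduces to that of \<open>\<eta>\<close>, a pathwise second difference inequality for the maximum,
  and \<open>h A \<le> harm (card A)\<close> follows from memorylessness.
\<close>

section \<open>Maxima of normalised exponential clocks\<close>

text \<open>Memorylessness. Below \<open>r\<close> the integrand is the constant \<open>F0\<close>,
  which collects the mass \<open>1 - exp (- l * r)\<close>; beyond \<open>r\<close> the overshoot
  \<open>y - r\<close> is again exponential of rate \<open>l\<close>, with the remaining mass
  \<open>exp (- l * r)\<close>.\<close>

lemma nn_integral_exponential_shift:
  fixes F :: "real \<Rightarrow> ennreal"
  assumes [measurable]: "F \<in> borel_measurable borel"
    and const: "\<And>y. y \<le> 0 \<Longrightarrow> F y = F0" and l: "0 < l" and r: "0 \<le> r"
  shows "(\<integral>\<^sup>+ y. F (y - r) \<partial>density lborel (exponential_density l)) =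
    ennreal (exp (- l * r)) * (\<integral>\<^sup>+ y. F y \<partial>density lborel (exponential_density l))
    + ennreal (1 - exp (- l * r)) * F0"
proof -
  let ?d = "exponential_density l"
  have "(\<integral>\<^sup>+ y. F (y - r) \<partial>density lborel ?d) = (\<integral>\<^sup>+ y. ennreal (?d y) * F (y - r) \<partial>lborel)"
    by (simp add: nn_integral_density)
  also have "\<dots> = (\<integral>\<^sup>+ y. F0 * (ennreal (?d y) * indicator {..r} y) + ennreal (?d y) * F (y - r) * indicator {r<..} y \<partial>lborel)"
    by (intro nn_integral_cong) (auto split: split_indicator simp: const mult.commute)
  also have "\<dots> = (\<integral>\<^sup>+ y. F0 * (ennreal (?d y) * indicator {..r} y) \<partial>lborel)
     + (\<integral>\<^sup>+ y. ennreal (?d y) * F (y - r) * indicator {r<..} y \<partial>lborel)"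
    by (intro nn_integral_add) auto
  also have "(\<integral>\<^sup>+ y. F0 * (ennreal (?d y) * indicator {..r} y) \<partial>lborel) = F0 * ennreal (1 - exp (- l * r))"
    using l r by (subst nn_integral_cmult) (auto simp: nn_integral_erlang_density erlang_CDF_0)
  also have "(\<integral>\<^sup>+ y. ennreal (?d y) * F (y - r) * indicator {r<..} y \<partial>lborel)
     = (\<integral>\<^sup>+ y. ennreal (?d (r + y)) * F y * indicator {0<..} y \<partial>lborel)"
    by (subst nn_integral_real_affine[where c=1 and t=r]) (auto intro!: nn_integral_cong split: split_indicator)
  also have "\<dots> = (\<integral>\<^sup>+ y. ennreal (exp (- l * r)) * (ennreal (?d y) * F y) \<partial>lborel)"
  \<comment> \<open>At \<open>y = 0\<close> the indicator of \<open>{0<..}\<close> vanishes while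
    the density does not, so the integrands may differ on this null set.\<close>
  proof (rule nn_integral_cong_AE, use AE_lborel_singleton[of 0] in eventually_elim)
    fix y :: real assume "y \<noteq> 0"
    have "ennreal (?d (r + y)) = ennreal (exp (- l * r)) * ennreal (?d y)" if "y > 0"
      using that r l by (simp add: exponential_density_def ennreal_mult'[symmetric] exp_add[symmetric] algebra_simps)
    then show "ennreal (?d (r + y)) * F y * indicator {0<..} y = ennreal (exp (- l * r)) * (ennreal (?d y) * F y)"
      using \<open>y \<noteq> 0\<close> by (cases "y > 0") (auto simp: mult.assoc exponential_density_def)
  qed
  also have "\<dots> = ennreal (exp (- l * r)) * (\<integral>\<^sup>+ y. F y \<partial>density lborel ?d)"
    by (subst nn_integral_cmult) (auto simp: nn_integral_density)
  finally show ?thesis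
    by (simp add: mult.commute add.commute)
qed

section \<open>Ring times and peaks for a single outcome of the clocks\<close>

locale exponential_clocks =
  fixes I :: "'c set" and rate :: "'c \<Rightarrow> real" and mem :: "'c \<Rightarrow> 'v set"
  assumes fin: "finite I" and rate_pos: "rate c > 0"
begin

definition clocks_of :: "'v \<Rightarrow> 'c set" where "clocks_of v = {c \<in> I. v \<in> mem c}"
definition total_rate :: "'v \<Rightarrow> real" where "total_rate v = sum rate (clocks_of v)"
definition ring :: "'v \<Rightarrow> ('c \<Rightarrow> real) \<Rightarrow> real" where "ring v X = Min (X ` clocks_of v)"
text \<open>
  Including \<open>0\<close> makes a clock at a nonpositive value equivalent to the removal of its members, so that
  clocks can be shifted below \<open>0\<close> without truncation.  If no clock contains \<open>v\<close>, then \<open>ring v X\<close> is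
  the junk value \<open>Min {}\<close>, which the factor \<open>total_rate v = 0\<close> cancels.
\<close>
definition peak :: "'v set \<Rightarrow> ('c \<Rightarrow> real) \<Rightarrow> real"
  where "peak A X = Max (insert 0 ((\<lambda>v. total_rate v * ring v X) ` A))"

lemma finite_clocks_of [simp]: "finite (clocks_of v)"
  using fin by (simp add: clocks_of_def)

lemma total_rate_nonneg [simp]: "0 \<le> total_rate v"
  by (simp add: total_rate_def sum_nonneg less_imp_le rate_pos)

lemma total_rate_pos_iff: "0 < total_rate v \<longleftrightarrow> clocks_of v \<noteq> {}"
  by (metis total_rate_def finite_clocks_of less_irrefl rate_pos sum.empty sum_pos)

lemma ring_le: "c \<in> clocks_of v \<Longrightarrow> ring v X \<le> X c"
  by (simp add: ring_def)

lemma ring_attained: "clocks_of v \<noteq> {} \<Longrightarrow> \<exists>c\<in>clocks_of v. ring v X = X c"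
  using Min_in[of "X ` clocks_of v"] unfolding ring_def by (metis finite_clocks_of finite_imageI image_iff image_is_empty)

lemma peak_nonneg [simp]: "finite A \<Longrightarrow> 0 \<le> peak A X"
  by (simp add: peak_def)

lemma peak_ge: "finite A \<Longrightarrow> v \<in> A \<Longrightarrow> total_rate v * ring v X \<le> peak A X"
  by (simp add: peak_def)

lemma peak_le_iff: "finite A \<Longrightarrow> peak A X \<le> z \<longleftrightarrow> 0 \<le> z \<and> (\<forall>v\<in>A. total_rate v * ring v X \<le> z)"
  by (simp add: peak_def)

text \<open>A positive peak cannot be the inserted \<open>0\<close>, and since
  \<open>total_rate v\<close> is nonnegative, a positive product makes both factors
  positive.\<close>

lemma peak_attained:
  assumes "finite A" "0 < peak A X"
  shows "\<exists>v\<in>A. peak A X = total_rate v * ring v X \<and> 0 < total_rate v \<and> 0 < ring v X"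
proof -
  have "peak A X \<in> insert 0 ((\<lambda>v. total_rate v * ring v X) ` A)"
    unfolding peak_def using assms by (intro Max_in) auto
  with assms obtain v where v: "v \<in> A" "peak A X = total_rate v * ring v X"
    by auto
  with assms(2) show ?thesis
    by (metis total_rate_nonneg zero_less_mult_iff not_less)
qed

lemma peak_empty [simp]: "peak {} X = 0"
  by (simp add: peak_def)

lemma peak_mono_set: "finite B \<Longrightarrow> A \<subseteq> B \<Longrightarrow> peak A X \<le> peak B X"
  by (auto simp: peak_le_iff finite_subset peak_ge subsetD)

lemma ring_mono: "(\<And>c. c \<in> clocks_of v \<Longrightarrow> X c \<le> X' c) \<Longrightarrow> clocks_of v \<noteq> {} \<Longrightarrow> ring v X \<le> ring v X'"
  by (metis ring_attained ring_le order_trans)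

lemma peak_mono:
  assumes "finite A" "\<And>c. c \<in> I \<Longrightarrow> X c \<le> X' c"
  shows "peak A X \<le> peak A X'"
  unfolding peak_le_iff[OF assms(1)]
proof (intro conjI ballI)
  fix v assume v: "v \<in> A"
  show "total_rate v * ring v X \<le> peak A X'"
  proof (cases "clocks_of v = {}")
    case True
    then show ?thesis using assms total_rate_pos_iff[of v] by (simp add: total_rate_def)
  next
    case False
    then have "ring v X \<le> ring v X'" by (intro ring_mono) (auto simp: clocks_of_def assms)
    then show ?thesis
      using peak_ge[OF assms(1) v, of X'] mult_left_mono[OF _ total_rate_nonneg] order_trans by blast
  qed
qed (use assms in simp)

text \<open>Members of \<open>mem c\<close> ring no later than \<open>y\<close>, so their terms are
  at most the inserted \<open>0\<close>; the ring time of any other \<open>v\<close> does not see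
  clock \<open>c\<close>.\<close>

lemma peak_update_nonpos:
  assumes A: "finite A" and c: "c \<in> I" and y: "y \<le> 0"
  shows "peak A (X(c := y)) = peak (A - mem c) X"
proof -
  have eq: "ring v (X(c := y)) = ring v X" if "v \<notin> mem c" for v
    unfolding ring_def using that by (intro arg_cong[where f=Min] image_cong) (auto simp: clocks_of_def)
  have le: "total_rate v * ring v (X(c := y)) \<le> 0" if "v \<in> mem c" for v
    using ring_le[of c v "X(c := y)"] that c y by (intro mult_nonneg_nonpos) (auto simp: clocks_of_def)
  show ?thesis
  proof (rule antisym)
    show "peak A (X(c := y)) \<le> peak (A - mem c) X"
      unfolding peak_le_iff[OF A]
    proof (intro conjI ballI)
      fix v assume v: "v \<in> A"
      show "total_rate v * ring v (X(c := y)) \<le> peak (A - mem c) X"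
      proof (cases "v \<in> mem c")
        case True
        then show ?thesis using le[OF True] A by (meson finite_Diff peak_nonneg order_trans)
      next
        case False
        then show ?thesis using eq v A by (simp add: peak_ge)
      qed
    qed (use A in simp)
    show "peak (A - mem c) X \<le> peak A (X(c := y))"
      using A eq by (auto simp: peak_le_iff) (metis peak_ge)
  qed
qed

section \<open>Mean peaks under shifts of independent clocks\<close>

definition clock_space :: "('c \<Rightarrow> real) measure"
  where "clock_space = (\<Pi>\<^sub>M c\<in>I. density lborel (exponential_density (rate c)))"

lemma peak_measurable:
  assumes "finite A" "\<And>c. c \<in> I \<Longrightarrow> (\<lambda>x. f x c) \<in> borel_measurable N"
  shows "(\<lambda>x. peak A (f x)) \<in> borel_measurable N"
proof -
  have "(\<lambda>x. ring v (f x)) \<in> borel_measurable N" for v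
    unfolding ring_def using assms by (intro borel_measurable_Min finite_clocks_of) (simp add: clocks_of_def)
  then have ring: "(\<lambda>x. total_rate v * ring v (f x)) \<in> borel_measurable N" for v
    by measurable
  \<comment> \<open>Indexing the inserted \<open>0\<close> by \<open>None\<close> turns the peak
    into one maximum of measurable functions over a finite index set.\<close>
  have eq: "(\<lambda>x. peak A (f x)) =
      (\<lambda>x. Max ((\<lambda>v. case v of None \<Rightarrow> 0 | Some v \<Rightarrow> total_rate v * ring v (f x)) ` (insert None (Some ` A))))"
    by (simp add: peak_def image_image)
  show ?thesis
    unfolding eq
  proof (rule borel_measurable_Max)
    fix i assume "i \<in> insert None (Some ` A)"
    then show "(\<lambda>x. case i of None \<Rightarrow> 0 | Some v \<Rightarrow> total_rate v * ring v (f x)) \<in> borel_measurable N"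
      using ring by (cases i) auto
  qed (use assms in auto)
qed

sublocale product_prob_space "\<lambda>c. density lborel (exponential_density (rate c))" I
  by (intro product_prob_spaceI prob_space_exponential_density rate_pos)

lemma clock_measurable_density:
  "c \<in> I \<Longrightarrow> (\<lambda>X. X c) \<in> measurable clock_space (density lborel (exponential_density (rate c)))"
  unfolding clock_space_def by (rule measurable_component_singleton)

lemma clock_measurable [measurable]: "c \<in> I \<Longrightarrow> (\<lambda>X. X c) \<in> borel_measurable clock_space"
  using clock_measurable_density by (simp add: measurable_def)

lemma distr_clock:
  assumes "c \<in> I"
  shows "distr clock_space (density lborel (exponential_density (rate c))) (\<lambda>X. X c) = density lborel (exponential_density (rate c))"
  unfolding clock_space_def using assms by (rule PiM_component)

lemma peak_shift_measurable [measurable]: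
  "finite A \<Longrightarrow> (\<lambda>X. peak A (\<lambda>c. X c - Y c)) \<in> borel_measurable clock_space"
  by (intro peak_measurable borel_measurable_diff clock_measurable) auto

text \<open>\<open>Y c\<close> is the time already elapsed on clock \<open>c\<close>. It is
  subtracted without truncation, so that all shifted systems live on one probability space and can
  be compared outcome by outcome. For nonnegative \<open>Y\<close> and finite \<open>A\<close> the
  integral is finite, so \<open>enn2real\<close> loses nothing.\<close>

definition peak_mean :: "'v set \<Rightarrow> ('c \<Rightarrow> real) \<Rightarrow> real"
  where "peak_mean A Y = enn2real (\<integral>\<^sup>+ X. ennreal (peak A (\<lambda>c. X c - Y c)) \<partial>clock_space)"

lemma nn_integral_clock:
  assumes c: "c \<in> I"
  shows "(\<integral>\<^sup>+ X. ennreal (X c) \<partial>clock_space) = ennreal (1 / rate c)"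
proof -
  let ?D = "density lborel (exponential_density (rate c))"
  have "(\<integral>\<^sup>+ X. ennreal (X c) \<partial>clock_space) = (\<integral>\<^sup>+ y. ennreal y \<partial>distr clock_space ?D (\<lambda>X. X c))"
    by (subst nn_integral_distr[OF clock_measurable_density[OF c]]) auto
  also have "\<dots> = (\<integral>\<^sup>+ y. ennreal y \<partial>?D)"
    using c by (simp add: distr_clock)
  also have "\<dots> = (\<integral>\<^sup>+ y. ennreal (exponential_density (rate c) y * y ^ 1) \<partial>lborel)"
    by (subst nn_integral_density)
       (auto intro!: nn_integral_cong simp: ennreal_mult'' exponential_density_def ennreal_mult')
  also have "\<dots> = ennreal (1 / rate c)"
    using nn_integral_erlang_ith_moment[OF rate_pos[of c], of 0 1] by simp
  finally show ?thesis .
qed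

text \<open>A crude domination: every clock containing \<open>v\<close> bounds its ring time, so the
  peak is at most the sum of all \<open>total_rate v * max 0 (X c)\<close>, and each clock has a
  finite mean.\<close>

lemma nn_integral_peak_finite:
  assumes A: "finite A" and Y: "\<And>c. c \<in> I \<Longrightarrow> 0 \<le> Y c"
  shows "(\<integral>\<^sup>+ X. ennreal (peak A (\<lambda>c. X c - Y c)) \<partial>clock_space) < \<infinity>"
proof -
  have "(\<integral>\<^sup>+ X. ennreal (peak A (\<lambda>c. X c - Y c)) \<partial>clock_space)
    \<le> (\<integral>\<^sup>+ X. (\<Sum>v\<in>A. \<Sum>c\<in>I. ennreal (total_rate v) * ennreal (X c)) \<partial>clock_space)"
  proof (rule nn_integral_mono)
    fix X
    have "peak A (\<lambda>c. X c - Y c) \<le> (\<Sum>v\<in>A. \<Sum>c\<in>I. total_rate v * max 0 (X c))"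
      unfolding peak_le_iff[OF A]
    proof (intro conjI ballI)
      fix v assume v: "v \<in> A"
      show "total_rate v * ring v (\<lambda>c. X c - Y c) \<le> (\<Sum>v\<in>A. \<Sum>c\<in>I. total_rate v * max 0 (X c))"
      proof (cases "clocks_of v = {}")
        case True
        then show ?thesis using total_rate_pos_iff[of v] by (auto simp: total_rate_def[of v] intro!: sum_nonneg)
      next
        case False
        then obtain c where c: "c \<in> clocks_of v" by auto
        then have cI: "c \<in> I" by (simp add: clocks_of_def)
        have "total_rate v * ring v (\<lambda>c. X c - Y c) \<le> total_rate v * max 0 (X c)"
          using ring_le[OF c, of "\<lambda>c. X c - Y c"] Y[OF cI] by (intro mult_left_mono) auto
        also have "\<dots> \<le> (\<Sum>c\<in>I. total_rate v * max 0 (X c))"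
          using cI fin by (intro member_le_sum) auto
        also have "\<dots> \<le> (\<Sum>v\<in>A. \<Sum>c\<in>I. total_rate v * max 0 (X c))"
          using v A by (intro member_le_sum) (auto intro!: sum_nonneg)
        finally show ?thesis .
      qed
    qed (auto intro!: sum_nonneg)
    then have "ennreal (peak A (\<lambda>c. X c - Y c)) \<le> ennreal (\<Sum>v\<in>A. \<Sum>c\<in>I. total_rate v * max 0 (X c))"
      by (rule ennreal_leI)
    also have "\<dots> = (\<Sum>v\<in>A. \<Sum>c\<in>I. ennreal (total_rate v) * ennreal (X c))"
      by (subst sum_ennreal[symmetric], force intro!: sum_nonneg)
         (auto intro!: sum.cong simp: sum_ennreal[symmetric] ennreal_mult' max_def ennreal_neg)
    finally show "ennreal (peak A (\<lambda>c. X c - Y c)) \<le> (\<Sum>v\<in>A. \<Sum>c\<in>I. ennreal (total_rate v) * ennreal (X c))" .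
  qed
  also have "\<dots> = (\<Sum>v\<in>A. \<Sum>c\<in>I. ennreal (total_rate v) * ennreal (1 / rate c))"
    by (simp add: nn_integral_sum nn_integral_cmult nn_integral_clock)
  also have "\<dots> < \<infinity>"
    by (simp add: ennreal_mult_less_top fin A)
  finally show ?thesis .
qed

lemma nn_integral_peak:
  assumes "finite A" "\<And>c. c \<in> I \<Longrightarrow> 0 \<le> Y c"
  shows "(\<integral>\<^sup>+ X. ennreal (peak A (\<lambda>c. X c - Y c)) \<partial>clock_space) = ennreal (peak_mean A Y)"
  unfolding peak_mean_def using nn_integral_peak_finite[OF assms] by (simp add: less_top)

lemma peak_mean_nonneg [simp]: "0 \<le> peak_mean A Y"
  by (simp add: peak_mean_def)

text \<open>Clock \<open>c\<close> is integrated first, by Fubini, and memorylessness is applied to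
  that inner integral. Because \<open>Y c\<close> is nonnegative, a clock value
  \<open>y \<le> 0\<close> gives \<open>y - Y c \<le> 0\<close>, where the peak is the constant peak
  over \<open>A - mem c\<close>.\<close>

lemma peak_mean_shift:
  assumes A: "finite A" and Y: "\<And>c. c \<in> I \<Longrightarrow> 0 \<le> Y c" and c: "c \<in> I" and r: "0 \<le> r"
  shows "peak_mean A (Y(c := Y c + r)) =
    exp (- rate c * r) * peak_mean A Y + (1 - exp (- rate c * r)) * peak_mean (A - mem c) Y"
proof -
  let ?D = "\<lambda>c. density lborel (exponential_density (rate c))"
  let ?J = "I - {c}"
  have J: "finite ?J" "c \<notin> ?J" "insert c ?J = I" using fin c by auto
  have meas: "(\<lambda>X. ennreal (peak B (\<lambda>c. X c - Z c))) \<in> borel_measurable (Pi\<^sub>M (insert c ?J) ?D)" if "finite B" for B Z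
    using peak_shift_measurable[OF that, of Z] unfolding J(3) clock_space_def by measurable
  have split: "(\<integral>\<^sup>+ X. ennreal (peak B (\<lambda>c. X c - Z c)) \<partial>clock_space) =
     (\<integral>\<^sup>+ X. (\<integral>\<^sup>+ y. ennreal (peak B ((\<lambda>c. X c - Z c)(c := y - Z c))) \<partial>?D c) \<partial>(Pi\<^sub>M ?J ?D))" if "finite B" for B Z
  proof -
    have "(\<lambda>d. (X(c := y)) d - Z d) = (\<lambda>c. X c - Z c)(c := y - Z c)" for X y
      by auto
    then show ?thesis
      using product_nn_integral_insert[OF J(1,2) meas[OF that, of Z]] unfolding J(3) clock_space_def by simp
  qed
  have [measurable]: "(\<lambda>X. peak B (\<lambda>c. X c - Z c)) \<in> borel_measurable (Pi\<^sub>M I ?D)" if "finite B" for B Z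
    using peak_shift_measurable[OF that, of Z] unfolding clock_space_def .
  \<comment> \<open>Over the product without coordinate \<open>c\<close>, that coordinate is set to
    \<open>0\<close>; this does not change the peak, since \<open>A - mem c\<close> ignores clock
    \<open>c\<close>.\<close>
  have meas2: "(\<lambda>X. ennreal (peak (A - mem c) (\<lambda>c. X c - Y c))) \<in> borel_measurable (Pi\<^sub>M ?J ?D)"
  proof -
    have "(\<lambda>X. peak (A - mem c) ((\<lambda>c. X c - Y c)(c := 0))) \<in> borel_measurable (Pi\<^sub>M ?J ?D)"
    proof (rule peak_measurable)
      fix d assume "d \<in> I"
      show "(\<lambda>X. ((\<lambda>c. X c - Y c)(c := 0)) d) \<in> borel_measurable (Pi\<^sub>M ?J ?D)"
      proof (cases "d = c")
        case False
        with \<open>d \<in> I\<close> have "(\<lambda>X. X d) \<in> borel_measurable (Pi\<^sub>M ?J ?D)"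
          using measurable_component_singleton[of d ?J ?D] by (simp add: measurable_def)
        then show ?thesis using False by simp
      qed simp
    qed (use A in simp)
    also have "(\<lambda>X. peak (A - mem c) ((\<lambda>c. X c - Y c)(c := 0))) = (\<lambda>X. peak (A - mem c) (\<lambda>c. X c - Y c))"
      using A c by (auto simp: peak_update_nonpos)
    finally show ?thesis by measurable
  qed
  have "(\<integral>\<^sup>+ X. ennreal (peak A (\<lambda>d. X d - (Y(c := Y c + r)) d)) \<partial>clock_space) =
     (\<integral>\<^sup>+ X. (\<integral>\<^sup>+ y. ennreal (peak A ((\<lambda>c. X c - Y c)(c := (y - r) - Y c))) \<partial>?D c) \<partial>(Pi\<^sub>M ?J ?D))"
  proof -
    have "(\<lambda>d. X d - (Y(c := Y c + r)) d)(c := y - (Y(c := Y c + r)) c) = (\<lambda>c. X c - Y c)(c := (y - r) - Y c)" for X y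
      by auto
    then show ?thesis by (subst split[OF A]) simp
  qed
  also have "\<dots> = (\<integral>\<^sup>+ X. ennreal (exp (- rate c * r)) * (\<integral>\<^sup>+ y. ennreal (peak A ((\<lambda>c. X c - Y c)(c := y - Y c))) \<partial>?D c)
        + ennreal (1 - exp (- rate c * r)) * ennreal (peak (A - mem c) (\<lambda>c. X c - Y c)) \<partial>(Pi\<^sub>M ?J ?D))"
  proof (rule nn_integral_cong)
    fix X
    have "(\<lambda>y. peak A ((\<lambda>c. X c - Y c)(c := y - Y c))) \<in> borel_measurable borel"
      by (rule peak_measurable) (use A in auto)
    then show "(\<integral>\<^sup>+ y. ennreal (peak A ((\<lambda>c. X c - Y c)(c := (y - r) - Y c))) \<partial>?D c)
      = ennreal (exp (- rate c * r)) * (\<integral>\<^sup>+ y. ennreal (peak A ((\<lambda>c. X c - Y c)(c := y - Y c))) \<partial>?D c)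
        + ennreal (1 - exp (- rate c * r)) * ennreal (peak (A - mem c) (\<lambda>c. X c - Y c))"
      using Y[OF c] A c
      by (intro nn_integral_exponential_shift[where F="\<lambda>y. ennreal (peak A ((\<lambda>c. X c - Y c)(c := y - Y c)))"] rate_pos r)
         (auto simp: peak_update_nonpos)
  qed
  also have "\<dots> = ennreal (exp (- rate c * r)) * (\<integral>\<^sup>+ X. (\<integral>\<^sup>+ y. ennreal (peak A ((\<lambda>c. X c - Y c)(c := y - Y c))) \<partial>?D c) \<partial>(Pi\<^sub>M ?J ?D))
     + ennreal (1 - exp (- rate c * r)) * (\<integral>\<^sup>+ X. ennreal (peak (A - mem c) (\<lambda>c. X c - Y c)) \<partial>(Pi\<^sub>M ?J ?D))"
  proof -
    have [measurable]: "(\<lambda>X. \<integral>\<^sup>+ y. ennreal (peak A ((\<lambda>c. X c - Y c)(c := y - Y c))) \<partial>?D c) \<in> borel_measurable (Pi\<^sub>M ?J ?D)"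
    proof -
      have "(\<lambda>(X, y). peak A ((\<lambda>c. X c - Y c)(c := y - Y c))) \<in> borel_measurable (Pi\<^sub>M ?J ?D \<Otimes>\<^sub>M ?D c)"
        unfolding case_prod_beta
      proof (rule peak_measurable)
        fix d assume "d \<in> I"
        show "(\<lambda>x. ((\<lambda>c. fst x c - Y c)(c := snd x - Y c)) d) \<in> borel_measurable (Pi\<^sub>M ?J ?D \<Otimes>\<^sub>M ?D c)"
        proof (cases "d = c")
          case False
          with \<open>d \<in> I\<close> have [measurable]: "(\<lambda>X. X d) \<in> borel_measurable (Pi\<^sub>M ?J ?D)"
            using measurable_component_singleton[of d ?J ?D] by (simp add: measurable_def)
          show ?thesis using False by simp
        next
          case True
          then show ?thesis by simp
        qed
      qed (use A in simp)
      then show ?thesis by measurable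
    qed
    show ?thesis using meas2
      by (subst nn_integral_add) (auto simp: nn_integral_cmult)
  qed
  also have "(\<integral>\<^sup>+ X. (\<integral>\<^sup>+ y. ennreal (peak A ((\<lambda>c. X c - Y c)(c := y - Y c))) \<partial>?D c) \<partial>(Pi\<^sub>M ?J ?D)) = ennreal (peak_mean A Y)"
    using split[OF A, of Y] nn_integral_peak[OF A, of Y] Y by simp
  also have "(\<integral>\<^sup>+ X. ennreal (peak (A - mem c) (\<lambda>c. X c - Y c)) \<partial>(Pi\<^sub>M ?J ?D)) = ennreal (peak_mean (A - mem c) Y)"
  proof -
    \<comment> \<open>The integral over clock \<open>c\<close> can be put back: the integrand does
      not depend on it, and its law has mass 1.\<close>
    have one: "emeasure (?D c) (space (?D c)) = 1"
      by (rule prob_space.emeasure_space_1[OF prob_space_exponential_density[OF rate_pos]])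
    have eq: "peak (A - mem c) ((\<lambda>c. X c - Y c)(c := y)) = peak (A - mem c) (\<lambda>c. X c - Y c)" for X y
    proof -
      have "ring v ((\<lambda>c. X c - Y c)(c := y)) = ring v (\<lambda>c. X c - Y c)" if "v \<notin> mem c" for v
        unfolding ring_def using that by (intro arg_cong[where f=Min] image_cong) (auto simp: clocks_of_def)
      then show ?thesis unfolding peak_def by (intro arg_cong[where f=Max]) auto
    qed
    show ?thesis
      using split[of "A - mem c" Y] nn_integral_peak[of "A - mem c" Y] A Y one
       by (simp add: eq)
  qed
  finally have "(\<integral>\<^sup>+ X. ennreal (peak A (\<lambda>d. X d - (Y(c := Y c + r)) d)) \<partial>clock_space) =
     ennreal (exp (- rate c * r) * peak_mean A Y + (1 - exp (- rate c * r)) * peak_mean (A - mem c) Y)"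
    using rate_pos[of c] r
    by (simp add: ennreal_mult'[symmetric] ennreal_plus[symmetric] del: ennreal_plus)
  then have "ennreal (peak_mean A (Y(c := Y c + r))) = ennreal (exp (- rate c * r) * peak_mean A Y + (1 - exp (- rate c * r)) * peak_mean (A - mem c) Y)"
    using nn_integral_peak[OF A, of "Y(c := Y c + r)"] Y c r by simp
  then show ?thesis
    using rate_pos[of c] r by (subst (asm) ennreal_inj) (auto intro!: add_nonneg_nonneg mult_nonneg_nonneg)
qed


lemma prob_space_clock_space: "prob_space clock_space"
  unfolding clock_space_def by (intro prob_space_PiM prob_space_exponential_density rate_pos)

text \<open>Passes from outcomes to means. Shorter inequalities fit the two-against-two shape by
  padding with \<open>{}\<close>, whose peak is \<open>0\<close>; the indicator term serves bounds
  that lose something only on an event.\<close>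

lemma peak_mean_le:
  assumes fin': "finite A" "finite B" "finite C" "finite D" and k: "0 \<le> k" and S: "S \<in> sets clock_space"
    and Y: "\<And>c. 0 \<le> Y1 c" "\<And>c. 0 \<le> Y2 c" "\<And>c. 0 \<le> Y3 c" "\<And>c. 0 \<le> Y4 c"
    and le: "\<And>X. X \<in> space clock_space \<Longrightarrow> peak A (\<lambda>c. X c - Y1 c) + peak B (\<lambda>c. X c - Y2 c)
      \<le> peak C (\<lambda>c. X c - Y3 c) + peak D (\<lambda>c. X c - Y4 c) + k * indicator S X"
  shows "peak_mean A Y1 + peak_mean B Y2 \<le> peak_mean C Y3 + peak_mean D Y4 + k * measure clock_space S"
proof -
  interpret prob_space clock_space by (rule prob_space_clock_space)
  note [measurable] = peak_shift_measurable S
  have "ennreal (peak_mean A Y1 + peak_mean B Y2) = (\<integral>\<^sup>+ X. ennreal (peak A (\<lambda>c. X c - Y1 c)) + ennreal (peak B (\<lambda>c. X c - Y2 c)) \<partial>clock_space)"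
    using fin' Y by (subst nn_integral_add) (auto simp: nn_integral_peak)
  also have "\<dots> \<le> (\<integral>\<^sup>+ X. ennreal (peak C (\<lambda>c. X c - Y3 c)) + ennreal (peak D (\<lambda>c. X c - Y4 c)) + ennreal k * indicator S X \<partial>clock_space)"
  proof (rule nn_integral_mono)
    fix X assume "X \<in> space clock_space"
    from ennreal_leI[OF le[OF this]] show "ennreal (peak A (\<lambda>c. X c - Y1 c)) + ennreal (peak B (\<lambda>c. X c - Y2 c))
      \<le> ennreal (peak C (\<lambda>c. X c - Y3 c)) + ennreal (peak D (\<lambda>c. X c - Y4 c)) + ennreal k * indicator S X"
      using fin' k by (auto simp: indicator_def split: if_splits)
  qed
  also have "\<dots> = ennreal (peak_mean C Y3 + peak_mean D Y4 + k * measure clock_space S)"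
    using fin' Y k
    by (simp add: nn_integral_add nn_integral_peak nn_integral_cmult emeasure_eq_measure ennreal_mult'')
  finally show ?thesis
    using k by (subst (asm) ennreal_le_iff) auto
qed

section \<open>Heights, thinning and its infinitesimal generator\<close>

definition height :: "'v set \<Rightarrow> real" where "height A = peak_mean A (\<lambda>_. 0)"
text \<open>Minus the generator, applied to \<open>height\<close>, of the process that deletes
  \<open>mem c\<close> at rate \<open>rate c\<close>; equivalently, the speed at which the mean peak
  falls when all clocks are shifted together.\<close>

definition height_drop :: "'v set \<Rightarrow> real" where "height_drop A = (\<Sum>c\<in>I. rate c * (height A - height (A - mem c)))"

text \<open>By memorylessness, shifting the clocks \<open>cs\<close> down by \<open>r\<close> amounts to removing the members of each of
  them independently with the probability that it rings before time \<open>r\<close>.\<close>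
primrec thin :: "real \<Rightarrow> 'c list \<Rightarrow> ('v set \<Rightarrow> real) \<Rightarrow> 'v set \<Rightarrow> real" where
  "thin r [] f A = f A"
| "thin r (c # cs) f A = exp (- rate c * r) * thin r cs f A + (1 - exp (- rate c * r)) * thin r cs f (A - mem c)"

text \<open>Each clock of the duplicate-free list is shifted once, by
  \<open>peak_mean_shift\<close>. The base shift \<open>Y\<close> is kept general because second
  differences need clocks that are shifted twice.\<close>

lemma peak_mean_shift_list:
  assumes "distinct cs" "set cs \<subseteq> I" "0 \<le> r" "finite A" "\<And>c. 0 \<le> Y c"
  shows "peak_mean A (\<lambda>c. if c \<in> set cs then Y c + r else Y c) = thin r cs (\<lambda>B. peak_mean B Y) A"
  using assms
proof (induction cs arbitrary: A)
  case (Cons c cs)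
  let ?Y = "\<lambda>c. if c \<in> set cs then Y c + r else Y c"
  have eq: "(\<lambda>d. if d \<in> set (c # cs) then Y d + r else Y d) = ?Y(c := ?Y c + r)"
    using Cons.prems by (auto simp: fun_eq_iff)
  show ?case
    unfolding eq using Cons.prems Cons.IH
    by (subst peak_mean_shift) (auto simp: add_nonneg_nonneg)
qed simp

lemma peak_mean_shift_list0:
  assumes "distinct cs" "set cs \<subseteq> I" "0 \<le> r" "finite A"
  shows "peak_mean A (\<lambda>c. if c \<in> set cs then r else 0) = thin r cs height A"
  using peak_mean_shift_list[OF assms, of "\<lambda>_. 0"] by (simp add: height_def[abs_def] cong: if_cong)

lemma thin_diff: "thin r cs (\<lambda>B. f B - g B) A = thin r cs f A - thin r cs g A"
proof (induction cs arbitrary: A)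
  case (Cons c cs)
  show ?case unfolding thin.simps Cons.IH by (simp add: algebra_simps)
qed simp

lemma thin_divide: "thin r cs (\<lambda>B. f B / k) A = thin r cs f A / k"
  by (induction cs arbitrary: A) (auto simp: add_divide_distrib)

text \<open>Deletions commute, so a fixed deletion may be done before or after the random
  ones.\<close>

lemma thin_Diff: "thin r cs (\<lambda>B. f (B - D)) A = thin r cs f (A - D)"
proof (induction cs arbitrary: A)
  case (Cons c cs)
  have "A - mem c - D = A - D - mem c" by auto
  then show ?case using Cons by simp
qed simp

lemma thin_vanish:
  assumes "\<And>B. v \<notin> B \<Longrightarrow> f B = 0"
  shows "v \<notin> A \<Longrightarrow> thin r cs f A = 0"
  using assms by (induction cs arbitrary: A) auto

text \<open>If any clock of \<open>cs\<close> rings, \<open>v\<close> is deleted and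
  \<open>f\<close> vanishes; only the branch in which none rings survives, and its probability is
  the exponential factor.\<close>

lemma thin_clocks_of:
  assumes "\<And>B. v \<notin> B \<Longrightarrow> f B = 0" "\<And>c. c \<in> set cs \<Longrightarrow> v \<in> mem c"
  shows "thin r cs f A = exp (- (\<Sum>c\<leftarrow>cs. rate c) * r) * f A"
  using assms(2)
proof (induction cs)
  case (Cons c cs)
  then have "thin r cs f (A - mem c) = 0"
    by (intro thin_vanish[of v] assms) auto
  with Cons show ?case by (simp add: algebra_simps exp_add[symmetric])
qed simp

lemma tendsto_exp_quotient: "((\<lambda>r. (1 - exp (- l * r)) / r) \<longlongrightarrow> l) (at_right (0::real))"
proof -
  have "((\<lambda>r. - exp (- l * r)) has_real_derivative l) (at 0)"
    by (auto intro!: derivative_eq_intros)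
  then have "((\<lambda>r. (1 - exp (- l * r)) / r) \<longlongrightarrow> l) (at 0)"
    by (simp add: has_field_derivative_def[symmetric] DERIV_def)
  then show ?thesis
    by (rule tendsto_mono[rotated]) (simp add: at_le)
qed

text \<open>To first order in \<open>r\<close> at most one clock rings. The function may itself
  depend on \<open>r\<close>, so that the lemma can be applied again to a difference
  quotient.\<close>

lemma thin_generator:
  fixes f :: "real \<Rightarrow> 'v set \<Rightarrow> real"
  assumes "\<And>A. ((\<lambda>r. f r A) \<longlongrightarrow> f0 A) (at_right 0)"
  shows "((\<lambda>r. (f r A - thin r cs (f r) A) / r) \<longlongrightarrow> (\<Sum>c\<leftarrow>cs. rate c * (f0 A - f0 (A - mem c)))) (at_right 0)"
proof (induction cs arbitrary: A)
  case (Cons c cs)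
  let ?G = "\<lambda>A r. thin r cs (f r) A"
  \<comment> \<open>The quotient in the induction hypothesis converges, so \<open>r\<close> times it
    tends to 0; this yields the limit of the thinned function itself.\<close>
  have G: "((\<lambda>r. ?G A r) \<longlongrightarrow> f0 A) (at_right 0)" for A
  proof -
    have "((\<lambda>r. f r A - r * ((f r A - ?G A r) / r)) \<longlongrightarrow> f0 A - 0 * (\<Sum>c\<leftarrow>cs. rate c * (f0 A - f0 (A - mem c)))) (at_right 0)"
      by (intro tendsto_intros assms Cons.IH)
    then have "((\<lambda>r. f r A - r * ((f r A - ?G A r) / r)) \<longlongrightarrow> f0 A) (at_right 0)"
      by simp
    moreover have "\<forall>\<^sub>F r in at_right (0::real). f r A - r * ((f r A - ?G A r) / r) = ?G A r"
      by (simp add: eventually_at_right_field) (metis zero_less_one)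
    ultimately show ?thesis
      by (rule Lim_transform_eventually)
  qed
  have eq: "(f r A - thin r (c # cs) (f r) A) / r =
      (f r A - ?G A r) / r + (1 - exp (- rate c * r)) / r * (?G A r - ?G (A - mem c) r)" for r
    by (simp add: divide_simps) (simp add: algebra_simps)
  have "((\<lambda>r. (f r A - ?G A r) / r + (1 - exp (- rate c * r)) / r * (?G A r - ?G (A - mem c) r)) \<longlongrightarrow>
     (\<Sum>c\<leftarrow>cs. rate c * (f0 A - f0 (A - mem c))) + rate c * (f0 A - f0 (A - mem c))) (at_right 0)"
    by (intro tendsto_intros Cons.IH G tendsto_exp_quotient)
  then show ?case unfolding eq by (simp add: add.commute)
qed simp

lemma clocks_of_list: "\<exists>cs. distinct cs \<and> set cs = J" if "J \<subseteq> I" for J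
  using finite_distinct_list[of J] finite_subset[OF that fin] by blast

lemma height_empty [simp]: "height {} = 0"
  by (simp add: height_def peak_mean_def)

lemma height_mono: "finite B \<Longrightarrow> A \<subseteq> B \<Longrightarrow> height A \<le> height B"
  using peak_mean_le[of A "{}" B "{}" 0 "{}" "\<lambda>_. 0" "\<lambda>_. 0" "\<lambda>_. 0" "\<lambda>_. 0"]
  by (simp add: height_def finite_subset peak_mono_set height_empty[unfolded height_def])

section \<open>Second differences of the peak and superharmonicity of the drop\<close>

lemma ring_minus: "clocks_of v \<noteq> {} \<Longrightarrow> (\<And>c. c \<in> clocks_of v \<Longrightarrow> X' c = X c - d) \<Longrightarrow> ring v X' = ring v X - d"
proof (rule antisym)
  assume *: "clocks_of v \<noteq> {}" "\<And>c. c \<in> clocks_of v \<Longrightarrow> X' c = X c - d"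
  show "ring v X' \<le> ring v X - d" using ring_attained[OF *(1), of X] ring_le[of _ v X'] * by force
  show "ring v X - d \<le> ring v X'" using ring_attained[OF *(1), of X'] ring_le[of _ v X] * by force
qed

text \<open>
  The maximum is attained at a smaller \<open>total_rate\<close> the later one looks.  Clocks containing all of \<open>A\<close> are
  exempt from the shift by \<open>J\<close>: if such a clock is the one that determines \<open>ring w\<close>, it bounds every other
  ring time, so that \<open>w\<close> itself may serve as the second maximiser.
\<close>
lemma peak_second_difference:
  assumes A: "finite A" and d: "0 \<le> d"
    and J: "J \<subseteq> I" "\<And>c. c \<in> I - J \<Longrightarrow> mem c \<inter> A = {} \<or> A \<subseteq> mem c"
    and Xi: "Xi = (\<lambda>c. X c - (if c \<in> I then d else 0))"
    and Xj: "Xj = (\<lambda>c. X c - (if c \<in> J then d else 0))"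
    and Xij: "Xij = (\<lambda>c. Xj c - (if c \<in> I then d else 0))"
  shows "peak A Xi + peak A Xj \<le> peak A X + peak A Xij"
proof -
  have "peak A Xi \<le> peak A X" "peak A Xj \<le> peak A X" "0 \<le> peak A Xij"
    using A d by (auto simp: Xi Xj intro!: peak_mono)
  then consider "peak A Xi + peak A Xj \<le> peak A X + peak A Xij" | "0 < peak A Xi" "0 < peak A Xj"
    using peak_nonneg[OF A] by (smt (verit))
  then show ?thesis
  proof cases
    case 2
    obtain v where v: "v \<in> A" "peak A Xi = total_rate v * ring v Xi" "0 < total_rate v" "0 < ring v Xi"
      using peak_attained[OF A 2(1)] by auto
    obtain w where w: "w \<in> A" "peak A Xj = total_rate w * ring w Xj" "0 < total_rate w" "0 < ring w Xj"
      using peak_attained[OF A 2(2)] by auto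
    have ne: "clocks_of v \<noteq> {}" "clocks_of w \<noteq> {}" using v w total_rate_pos_iff by auto
    have Ti: "ring u Xi = ring u X - d" "ring u Xij = ring u Xj - d" if "clocks_of u \<noteq> {}" for u
      using that by (auto intro!: ring_minus simp: Xi Xij clocks_of_def)
    have Tj: "ring u X - d \<le> ring u Xj" if "clocks_of u \<noteq> {}" for u
    proof -
      have "ring u Xi \<le> ring u Xj" using that J(1) d by (intro ring_mono) (auto simp: Xi Xj)
      then show ?thesis using Ti(1)[OF that] by simp
    qed
    \<comment> \<open>Evaluating \<open>peak A X\<close> at \<open>v'\<close> and
      \<open>peak A Xij\<close> at \<open>w\<close> leaves an error of
      \<open>(total_rate w - total_rate v') * d\<close>, which is nonpositive here.\<close>
    have main: ?thesis if "total_rate w \<le> total_rate v'" "v' \<in> A" "peak A Xi \<le> total_rate v' * (ring v' X - d)" for v'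
    proof -
      have "total_rate v' * ring v' X \<le> peak A X" "total_rate w * ring w Xij \<le> peak A Xij"
        using peak_ge[OF A] that w by auto
      moreover have "total_rate w * d \<le> total_rate v' * d"
        using that d by (simp add: mult_right_mono)
      ultimately show ?thesis
        using that(3) w(2) Ti(2)[OF ne(2)] by (simp add: algebra_simps)
    qed
    show ?thesis
    proof (cases "total_rate w \<le> total_rate v")
      case True
      then show ?thesis using main[of v] v Ti(1)[OF ne(1)] by simp
    next
      case less: False
      show ?thesis
      proof (cases "ring w Xj \<le> ring w X - d")
        case True
        \<comment> \<open>Now the evaluation points are exchanged: \<open>peak A X\<close> at
          \<open>w\<close> and \<open>peak A Xij\<close> at \<open>v\<close>, with error
          \<open>(total_rate v - total_rate w) * d\<close>.\<close>
        have "total_rate w * ring w X \<le> peak A X" "total_rate v * ring v Xij \<le> peak A Xij"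
          using peak_ge[OF A] v w by auto
        moreover have "total_rate w * ring w Xj \<le> total_rate w * (ring w X - d)"
          using True w by simp
        moreover have "total_rate v * (ring v X - d) \<le> total_rate v * ring v Xj"
          using Tj[OF ne(1)] v by simp
        moreover have "total_rate v * d \<le> total_rate w * d"
          using less d by (simp add: mult_right_mono)
        ultimately show ?thesis
          using v(2) w(2) Ti[OF ne(1)] by (simp add: algebra_simps)
      next
        case False
        obtain c where c: "c \<in> clocks_of w" "ring w X = X c" using ring_attained[OF ne(2)] by metis
        have "c \<notin> J" using ring_le[OF c(1), of Xj] False c(2) by (auto simp: Xj)
        then have "A \<subseteq> mem c" using J(2)[of c] c(1) w(1) by (auto simp: clocks_of_def)
        then have "c \<in> clocks_of v" using v(1) c(1) by (auto simp: clocks_of_def)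
        then have "ring v X \<le> ring w X" using ring_le[of c v X] c(2) by simp
        moreover have "0 < ring v X - d" using v(4) Ti(1)[OF ne(1)] by simp
        ultimately have "total_rate v * (ring v X - d) \<le> total_rate w * (ring w X - d)"
          using less by (intro mult_mono) auto
        then show ?thesis using main[of w] w v(2) Ti(1)[OF ne(1)] by simp
      qed
    qed
  qed
qed

text \<open>The generator is applied twice through difference quotients: \<open>f r\<close> comes
  from shifting all clocks by \<open>r\<close>, and the second shift concerns only the clocks
  \<open>J\<close> that split \<open>A\<close>. Integrating \<open>peak_second_difference\<close>
  makes every iterated quotient nonnegative, and \<open>r\<close> tends to 0.\<close>

lemma height_drop_superharmonic:
  assumes A: "finite A"
  shows "0 \<le> (\<Sum>c | c \<in> I \<and> mem c \<inter> A \<noteq> {} \<and> \<not> A \<subseteq> mem c. rate c * (height_drop A - height_drop (A - mem c)))"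
proof -
  define J where "J = {c \<in> I. mem c \<inter> A \<noteq> {} \<and> \<not> A \<subseteq> mem c}"
  obtain xs js where il: "distinct xs" "set xs = I" and jl: "distinct js" "set js = J"
    using clocks_of_list[of I] clocks_of_list[of J] by (auto simp: J_def)
  define f where "f = (\<lambda>r B. (height B - thin r xs height B) / r)"
  have f: "((\<lambda>r. f r B) \<longlongrightarrow> height_drop B) (at_right 0)" for B
    using thin_generator[of "\<lambda>_. height" height B xs] unfolding f_def height_drop_def
    by (simp add: sum_list_distinct_conv_sum_set il)
  have "((\<lambda>r. (f r A - thin r js (f r) A) / r) \<longlongrightarrow> (\<Sum>c\<in>J. rate c * (height_drop A - height_drop (A - mem c)))) (at_right 0)"
    using thin_generator[of f height_drop A js, OF f] by (simp add: sum_list_distinct_conv_sum_set jl)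
  moreover have "\<forall>\<^sub>F r in at_right (0::real). 0 \<le> (f r A - thin r js (f r) A) / r"
    unfolding eventually_at_right_field
  proof (intro exI[of _ 1] conjI allI impI)
    fix r :: real assume r: "0 < r" "r < 1"
    let ?Yi = "\<lambda>c. if c \<in> I then r else 0" and ?Yj = "\<lambda>c. if c \<in> J then r else 0"
    let ?Yij = "\<lambda>c. if c \<in> J then ?Yi c + r else ?Yi c"
    have i: "peak_mean B ?Yi = thin r xs height B" if "finite B" for B
      using peak_mean_shift_list0[of xs r B] that il r by simp
    have j: "peak_mean A ?Yj = thin r js height A"
      using peak_mean_shift_list0[of js r A] A jl r by (simp add: J_def)
    have ij: "peak_mean A ?Yij = thin r js (\<lambda>B. peak_mean B ?Yi) A"
      using peak_mean_shift_list[of js r A ?Yi] A jl r by (simp add: J_def)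
    \<comment> \<open>\<open>thin\<close> evaluates its function only at sets obtained from
      \<open>A\<close> by deletions; these are finite, so \<open>i\<close> applies.\<close>
    have "thin r js (\<lambda>B. peak_mean B ?Yi) A = thin r js (\<lambda>B. thin r xs height B) A"
      using A i
    proof (induction js arbitrary: A)
      case (Cons c cs) then show ?case by simp
    qed simp
    with ij have ij': "peak_mean A ?Yij = thin r js (\<lambda>B. thin r xs height B) A" by simp
    have "peak_mean A ?Yi + peak_mean A ?Yj \<le> peak_mean A (\<lambda>_. 0) + peak_mean A ?Yij + 0 * measure clock_space {}"
    proof (rule peak_mean_le)
      fix X
      show "peak A (\<lambda>c. X c - ?Yi c) + peak A (\<lambda>c. X c - ?Yj c)
        \<le> peak A (\<lambda>c. X c - 0) + peak A (\<lambda>c. X c - ?Yij c) + 0 * indicator {} X"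
      proof -
        have eq: "(\<lambda>c. X c - ?Yij c) = (\<lambda>c. X c - (if c \<in> J then r else 0) - (if c \<in> I then r else 0))"
          by auto
        have "peak A (\<lambda>c. X c - ?Yi c) + peak A (\<lambda>c. X c - ?Yj c) \<le> peak A X + peak A (\<lambda>c. X c - ?Yij c)"
          unfolding eq by (rule peak_second_difference[OF A, of r J]) (use r J_def in auto)
        then show ?thesis by simp
      qed
    qed (use A r in auto)
    then have "0 \<le> height A - thin r xs height A - (thin r js height A - thin r js (thin r xs height) A)"
      using i[OF A] j ij' by (simp add: height_def[symmetric])
    also have "\<dots> = r * (f r A - thin r js (f r) A)"
      unfolding f_def thin_divide thin_diff using r by (simp add: field_simps)
    finally show "0 \<le> (f r A - thin r js (f r) A) / r"
      using r by (simp add: zero_le_mult_iff)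
  qed simp
  ultimately have "0 \<le> (\<Sum>c\<in>J. rate c * (height_drop A - height_drop (A - mem c)))"
    by (rule tendsto_lowerbound) simp
  then show ?thesis by (simp add: J_def)
qed

section \<open>The harmonic upper bound on the height\<close>

lemma shift_gap:
  assumes v: "finite A" and r: "0 \<le> r"
  shows "(1 - exp (- total_rate v * r)) * (height A - height (A - {v})) =
      height A - peak_mean A (\<lambda>c. if c \<in> clocks_of v then r else 0) - (height (A - {v}) - peak_mean (A - {v}) (\<lambda>c. if c \<in> clocks_of v then r else 0))"
proof -
  obtain vs where vs: "distinct vs" "set vs = clocks_of v"
    using clocks_of_list[of "clocks_of v"] by (auto simp: clocks_of_def)
  have i: "peak_mean B (\<lambda>c. if c \<in> clocks_of v then r else 0) = thin r vs height B" if "finite B" for B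
    using peak_mean_shift_list0[of vs r B] that vs r by (simp add: clocks_of_def)
  \<comment> \<open>The gap vanishes on sets without \<open>v\<close>, so
    \<open>thin_clocks_of\<close> leaves only the event that no clock of \<open>v\<close> rings
    before \<open>r\<close>.\<close>
  have "thin r vs (\<lambda>B. height B - height (B - {v})) A = exp (- total_rate v * r) * (height A - height (A - {v}))"
    using thin_clocks_of[of v "\<lambda>B. height B - height (B - {v})" vs r A] vs
    by (simp add: total_rate_def sum_list_distinct_conv_sum_set clocks_of_def)
  then have "exp (- total_rate v * r) * (height A - height (A - {v})) = thin r vs height A - thin r vs height (A - {v})"
    by (simp add: thin_diff thin_Diff)
  with i v show ?thesis
    by (simp add: algebra_simps)
qed


lemma peak_zero_shift_measurable: "finite A \<Longrightarrow> peak A \<in> borel_measurable clock_space"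
  using peak_shift_measurable[of A "\<lambda>_. 0"] by simp

text \<open>
  Given that \<open>v\<close> attains the maximum, its lead over the others is dominated by a standard exponential
  variable, since shifting the clocks of \<open>v\<close> back can only lower the others.
\<close>
lemma sum_gap_le_1:
  assumes A: "finite A"
  shows "(\<Sum>v\<in>A. height A - height (A - {v})) \<le> 1"
proof -
  interpret prob_space clock_space by (rule prob_space_clock_space)
  \<comment> \<open>The event that \<open>v\<close> is the only maximiser. These events are disjoint
    for distinct \<open>v\<close>, so their probabilities add up to at most 1; this is where the
    bound 1 comes from.\<close>
  define S where "S = (\<lambda>v. {X \<in> space clock_space. peak (A - {v}) X < peak A X})"
  have S [measurable]: "S v \<in> sets clock_space" for v
    unfolding S_def using A by (intro borel_measurable_less peak_zero_shift_measurable) auto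
  have top: "u = v" if "X \<in> S v" "u \<in> A" "peak A X = total_rate u * ring u X" for u v X
    using that A peak_ge[of "A - {v}" u X] by (auto simp: S_def)
  have "disjoint_family_on S A"
    unfolding disjoint_family_on_def
  proof (intro ballI impI)
    fix v w assume "v \<in> A" "w \<in> A" "v \<noteq> w"
    show "S v \<inter> S w = {}"
    proof (rule ccontr)
      assume "S v \<inter> S w \<noteq> {}"
      then obtain X where X: "X \<in> S v" "X \<in> S w" by auto
      then have "0 < peak A X"
        using le_less_trans[OF peak_nonneg[of "A - {v}" X], of "peak A X"] A by (simp add: S_def)
      from peak_attained[OF A this] obtain u where "u \<in> A" "peak A X = total_rate u * ring u X" by auto
      with top X \<open>v \<noteq> w\<close> show False by metis
    qed
  qed
  then have "(\<Sum>v\<in>A. measure clock_space (S v)) = measure clock_space (\<Union>v\<in>A. S v)"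
    using A by (intro finite_measure_finite_Union[symmetric]) auto
  then have S_le: "(\<Sum>v\<in>A. measure clock_space (S v)) \<le> 1" by simp
  \<comment> \<open>Shifting the clocks of \<open>v\<close> by \<open>r\<close> lowers the peak by
    at most \<open>total_rate v * r\<close> on \<open>S v\<close>; elsewhere \<open>A - {v}\<close>
    has the same peak and absorbs the loss. Integration and \<open>shift_gap\<close> give the
    estimate.\<close>
  have gap: "(1 - exp (- total_rate v * r)) * (height A - height (A - {v})) \<le> total_rate v * r * measure clock_space (S v)"
    if v: "v \<in> A" and r: "0 < r" for v r
  proof -
    let ?Y = "\<lambda>c. if c \<in> clocks_of v then r else 0"
    have "peak_mean A (\<lambda>_. 0) + peak_mean (A - {v}) ?Y \<le> peak_mean A ?Y + peak_mean (A - {v}) (\<lambda>_. 0) + (total_rate v * r) * measure clock_space (S v)"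
    proof (rule peak_mean_le)
      fix X assume X: "X \<in> space clock_space"
      let ?X = "\<lambda>c. X c - ?Y c"
      have mono: "peak (A - {v}) ?X \<le> peak (A - {v}) X" "peak (A - {v}) ?X \<le> peak A ?X"
        using A r by (auto intro!: peak_mono peak_mono_set)
      show "peak A (\<lambda>c. X c - 0) + peak (A - {v}) ?X \<le> peak A ?X + peak (A - {v}) (\<lambda>c. X c - 0)
         + total_rate v * r * indicator (S v) X"
      proof (cases "X \<in> S v")
        case True
        then have "0 < peak A X"
          using le_less_trans[OF peak_nonneg[of "A - {v}" X], of "peak A X"] A by (simp add: S_def)
        from peak_attained[OF A this] obtain u where "u \<in> A" "peak A X = total_rate u * ring u X" "0 < total_rate u" by auto
        with top[OF True] have v': "peak A X = total_rate v * ring v X" "0 < total_rate v" by auto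
        then have "ring v ?X = ring v X - r" using total_rate_pos_iff by (intro ring_minus) auto
        then have "total_rate v * (ring v X - r) \<le> peak A ?X"
          using peak_ge[OF A v, of ?X] by simp
        then have "peak A X - total_rate v * r \<le> peak A ?X"
          using v' by (simp add: algebra_simps)
        with mono True show ?thesis by simp
      next
        case False
        then have "peak A X \<le> peak (A - {v}) X" using X by (simp add: S_def)
        with mono False show ?thesis by simp
      qed
    qed (use A r in auto)
    then show ?thesis
      using shift_gap[OF A, of r v] r by (simp add: height_def[symmetric])
  qed
  \<comment> \<open>Dividing \<open>1 - exp (- total_rate v * r)\<close> by
    \<open>total_rate v * r\<close> gives a factor tending to 1. Elements with
    \<open>total_rate v = 0\<close> are set aside; their term in the peak is \<open>0\<close>, so
    their gap is nonpositive.\<close>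
  have "((\<lambda>r. \<Sum>v\<in>A. (if total_rate v = 0 then 0 else (1 - exp (- total_rate v * r)) / r / total_rate v * (height A - height (A - {v})))) \<longlongrightarrow>
      (\<Sum>v\<in>A. if total_rate v = 0 then 0 else total_rate v / total_rate v * (height A - height (A - {v})))) (at_right 0)"
  proof (intro tendsto_sum)
    fix v
    show "((\<lambda>r. if total_rate v = 0 then 0 else (1 - exp (- total_rate v * r)) / r / total_rate v * (height A - height (A - {v}))) \<longlongrightarrow>
      (if total_rate v = 0 then 0 else total_rate v / total_rate v * (height A - height (A - {v})))) (at_right 0)"
    proof (cases "total_rate v = 0")
      case False
      have "((\<lambda>r. (1 - exp (- total_rate v * r)) / r / total_rate v * (height A - height (A - {v}))) \<longlongrightarrow>
          total_rate v / total_rate v * (height A - height (A - {v}))) (at_right 0)"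
        by (intro tendsto_intros tendsto_exp_quotient False)
      with False show ?thesis by (simp only: if_False)
    qed simp
  qed
  moreover have "\<forall>\<^sub>F r in at_right (0::real). (\<Sum>v\<in>A. (if total_rate v = 0 then 0 else (1 - exp (- total_rate v * r)) / r / total_rate v * (height A - height (A - {v})))) \<le> 1"
    unfolding eventually_at_right_field
  proof (intro exI[of _ 1] conjI allI impI)
    fix r :: real assume r: "0 < r"
    have "(\<Sum>v\<in>A. (if total_rate v = 0 then 0 else (1 - exp (- total_rate v * r)) / r / total_rate v * (height A - height (A - {v}))))
      \<le> (\<Sum>v\<in>A. measure clock_space (S v))"
    proof (rule sum_mono)
      fix v assume v: "v \<in> A"
      show "(if total_rate v = 0 then 0 else (1 - exp (- total_rate v * r)) / r / total_rate v * (height A - height (A - {v}))) \<le> measure clock_space (S v)"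
      proof (cases "total_rate v = 0")
        case False
        then have "0 < total_rate v" using total_rate_nonneg[of v] by linarith
        then show ?thesis using gap[OF v r] r by (simp add: field_simps)
      qed simp
    qed
    with S_le show "(\<Sum>v\<in>A. (if total_rate v = 0 then 0 else (1 - exp (- total_rate v * r)) / r / total_rate v * (height A - height (A - {v})))) \<le> 1"
      by linarith
  qed simp
  ultimately have "(\<Sum>v\<in>A. if total_rate v = 0 then 0 else total_rate v / total_rate v * (height A - height (A - {v}))) \<le> 1"
    by (rule tendsto_upperbound) simp
  moreover have "(\<Sum>v\<in>A. height A - height (A - {v})) \<le> (\<Sum>v\<in>A. if total_rate v = 0 then 0 else total_rate v / total_rate v * (height A - height (A - {v})))"
  proof (rule sum_mono)
    fix v assume v: "v \<in> A"
    have "height A \<le> height (A - {v})" if "total_rate v = 0"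
    proof -
      have "peak A X \<le> peak (A - {v}) X" for X
        unfolding peak_le_iff[OF A] using A that peak_ge[of "A - {v}" _ X] peak_nonneg[of "A - {v}" X] by (metis DiffI finite_Diff mult_zero_left singletonD)
      then show ?thesis
        using peak_mean_le[of A "{}" "A - {v}" "{}" 0 "{}" "\<lambda>_. 0" "\<lambda>_. 0" "\<lambda>_. 0" "\<lambda>_. 0"] A
        by (simp add: height_def[symmetric])
    qed
    then show "height A - height (A - {v}) \<le> (if total_rate v = 0 then 0 else total_rate v / total_rate v * (height A - height (A - {v})))"
      by auto
  qed
  ultimately show ?thesis by linarith
qed

text \<open>By \<open>sum_gap_le_1\<close> some \<open>v\<close> has a gap of at most the average
  \<open>1 / card A\<close>. Deleting such elements one after another adds up these averages to the
  harmonic number.\<close>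

lemma height_le_harm: "finite A \<Longrightarrow> height A \<le> harm (card A)"
proof (induction A rule: finite_psubset_induct)
  case (psubset A)
  show ?case
  proof (cases "A = {}")
    case False
    then have c: "0 < card A" using psubset.hyps by (simp add: card_gt_0_iff)
    have "\<exists>v\<in>A. height A - height (A - {v}) \<le> 1 / card A"
    proof (rule ccontr)
      assume "\<not> ?thesis"
      then have "(\<Sum>v\<in>A. 1 / card A) < (\<Sum>v\<in>A. height A - height (A - {v}))"
        using False psubset.hyps by (intro sum_strict_mono) auto
      then show False using sum_gap_le_1[OF psubset.hyps] c by simp
    qed
    then obtain v where v: "v \<in> A" "height A - height (A - {v}) \<le> 1 / card A" by auto
    have "height (A - {v}) \<le> harm (card (A - {v}))"
      using v by (intro psubset.IH) auto
    moreover have "card A = Suc (card (A - {v}))"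
      using v psubset.hyps c by simp
    ultimately show ?thesis
      using v(2) by (simp add: harm_Suc inverse_eq_divide)
  qed (simp add: harm_def)
qed

text \<open>A short shift by \<open>r\<close> lowers the mean by at least
  \<open>total_rate v * r\<close> times the probability that no clock of \<open>v\<close> has rung
  by \<open>r\<close>, which is at least \<open>1 - total_rate v * r\<close> by a union bound. By
  \<open>shift_gap\<close> the loss is at most \<open>total_rate v * r * height {v}\<close>.
  Cancelling and letting \<open>r\<close> tend to 0 gives the claim.\<close>

lemma height_singleton_ge_1:
  assumes a: "0 < total_rate v"
  shows "1 \<le> height {v}"
proof -
  interpret prob_space clock_space by (rule prob_space_clock_space)
  have ne: "clocks_of v \<noteq> {}" using a total_rate_pos_iff by simp
  have "1 - total_rate v * r \<le> height {v}" if r: "0 < r" for r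
  proof -
    let ?Y = "\<lambda>c. if c \<in> clocks_of v then r else 0"
    let ?N = "\<lambda>c. {X \<in> space clock_space. X c \<le> r}"
    have N [measurable]: "?N c \<in> sets clock_space" if "c \<in> I" for c
      using that by measurable
    have Nc: "measure clock_space (?N c) \<le> rate c * r" if c: "c \<in> I" for c
    proof -
      let ?D = "density lborel (exponential_density (rate c))"
      have "emeasure clock_space (?N c) = emeasure (distr clock_space ?D (\<lambda>X. X c)) {..r}"
        by (subst emeasure_distr[OF clock_measurable_density[OF c]]) (auto intro!: arg_cong2[where f=emeasure])
      also have "\<dots> = emeasure ?D {..r}"
        using c by (simp add: distr_clock)
      also have "\<dots> = ennreal (1 - exp (- rate c * r))"
        using r emeasure_erlang_density[OF rate_pos, of 0 c r] by (simp add: erlang_CDF_0)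
      finally have "measure clock_space (?N c) = 1 - exp (- rate c * r)"
        using rate_pos[of c] r by (simp add: measure_def)
      also have "\<dots> \<le> rate c * r"
        using exp_ge_add_one_self[of "- rate c * r"] by simp
      finally show ?thesis .
    qed
    define S where "S = space clock_space - (\<Union>c\<in>clocks_of v. ?N c)"
    have [measurable]: "(\<Union>c\<in>clocks_of v. ?N c) \<in> sets clock_space"
      by (intro sets.finite_UN finite_clocks_of N) (simp add: clocks_of_def)
    have S [measurable]: "S \<in> sets clock_space" by (simp add: S_def)
    have "measure clock_space (\<Union>c\<in>clocks_of v. ?N c) \<le> (\<Sum>c\<in>clocks_of v. measure clock_space (?N c))"
      by (intro finite_measure_subadditive_finite finite_clocks_of) (auto simp: clocks_of_def)
    also have "\<dots> \<le> (\<Sum>c\<in>clocks_of v. rate c * r)"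
      by (intro sum_mono Nc) (simp add: clocks_of_def)
    also have "\<dots> = total_rate v * r" by (simp add: total_rate_def sum_distrib_right)
    finally have PS: "1 - total_rate v * r \<le> measure clock_space S"
      by (simp add: S_def prob_compl)
    have bound: "total_rate v * r * indicator S X + peak {v} (\<lambda>c. X c - ?Y c) \<le> peak {v} X" if X: "X \<in> space clock_space" for X
    proof (cases "X \<in> S")
      case True
      obtain c where c: "c \<in> clocks_of v" "ring v X = X c" using ring_attained[OF ne] by metis
      have "r < ring v X" using True c X by (auto simp: S_def not_le)
      moreover have "ring v (\<lambda>c. X c - ?Y c) = ring v X - r" using ne by (intro ring_minus) auto
      ultimately have "peak {v} (\<lambda>c. X c - ?Y c) = total_rate v * (ring v X - r)"
        using a by (simp add: peak_def)
      then show ?thesis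
        using True peak_ge[of "{v}" v X] by (simp add: algebra_simps)
    next
      case False
      then show ?thesis using r by (auto intro!: peak_mono)
    qed
    have fin1: "finite {v}" by simp
    have "ennreal (total_rate v * r * measure clock_space S + peak_mean {v} ?Y) = (\<integral>\<^sup>+ X. ennreal (total_rate v * r) * indicator S X + ennreal (peak {v} (\<lambda>c. X c - ?Y c)) \<partial>clock_space)"
      using r peak_shift_measurable[OF fin1]
      by (simp add: nn_integral_add nn_integral_peak nn_integral_cmult emeasure_eq_measure ennreal_mult'')
    also have "\<dots> \<le> (\<integral>\<^sup>+ X. ennreal (peak {v} (\<lambda>c. X c - 0)) \<partial>clock_space)"
    proof (rule nn_integral_mono)
      fix X assume "X \<in> space clock_space"
      from ennreal_leI[OF bound[OF this]] show "ennreal (total_rate v * r) * indicator S X + ennreal (peak {v} (\<lambda>c. X c - ?Y c)) \<le> ennreal (peak {v} (\<lambda>c. X c - 0))"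
        using r by (auto simp: indicator_def split: if_splits)
    qed
    also have "\<dots> = ennreal (height {v})"
      by (subst nn_integral_peak) (auto simp: height_def)
    finally have "total_rate v * r * measure clock_space S + peak_mean {v} ?Y \<le> height {v}"
      by (simp add: height_def)
    moreover have "height {v} - peak_mean {v} ?Y = (1 - exp (- total_rate v * r)) * height {v}"
      using shift_gap[of "{v}" r v] r by (simp add: peak_mean_def)
    moreover have "(1 - exp (- total_rate v * r)) * height {v} \<le> (total_rate v * r) * height {v}"
      using exp_ge_add_one_self[of "- total_rate v * r"] by (intro mult_right_mono) (auto simp: height_def)
    ultimately have "total_rate v * r * measure clock_space S \<le> total_rate v * r * height {v}" by linarith
    then have "measure clock_space S \<le> height {v}" using a r by simp
    with PS show ?thesis by linarith
  qed
  note * = this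
  show ?thesis
  proof (rule field_le_epsilon)
    fix e :: real assume "0 < e"
    with *[of "e / total_rate v"] a show "1 \<le> height {v} + e" by simp
  qed
qed

end

section \<open>The potential\<close>

text \<open>The purely algebraic part. The balance rests on \<open>LB\<close>: under the cuts that
  keep \<open>u\<close>, the term \<open>B\<close> loses exactly the average amount of
  \<open>eta\<close> that enters the potential when \<open>u\<close> is cut off.\<close>

lemma potential_of_height:
  fixes \<mu> h :: "'v set \<Rightarrow> real" and U :: "'v set" and u :: 'v
  defines "W \<equiv> U - {u}"
  defines "eta \<equiv> \<lambda>A. \<Sum>S\<in>Pow W. \<mu> S * (h A - h (A - S))"
  assumes U: "finite U" "u \<in> U" and \<mu>: "\<And>S. 0 \<le> \<mu> S"
    and h0: "h {} = 0" and h_mono: "\<And>A B. B \<subseteq> W \<Longrightarrow> A \<subseteq> B \<Longrightarrow> h A \<le> h B"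
    and h_harm: "\<And>A. A \<subseteq> W \<Longrightarrow> h A \<le> harm (card A)"
    and h_single: "\<And>v. v \<in> W \<Longrightarrow> 0 < (\<Sum>S | S \<in> Pow W \<and> v \<in> S. \<mu> S) \<Longrightarrow> 1 \<le> h {v}"
    and super: "\<And>A. A \<subseteq> W \<Longrightarrow>
      0 \<le> (\<Sum>S\<in>Pow W. if S \<inter> A \<noteq> {} \<and> \<not> A \<subseteq> S then \<mu> S * (eta A - eta (A - S)) else 0)"
  shows "\<exists>\<Phi>. (\<forall>A\<subseteq>U. 0 \<le> \<Phi> A) \<and>
    (\<forall>v\<in>U. (\<Sum>S | S \<in> Pow U \<and> v \<in> S. \<mu> S) \<le> \<Phi> {v}) \<and>
    \<Phi> U \<le> (1 + harm (card U - 1)) * (\<Sum>S | S \<in> Pow U \<and> u \<in> S. \<mu> S) \<and>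
    (\<forall>A\<subseteq>U. A \<noteq> {} \<longrightarrow> 0 \<le> (\<Sum>S\<in>Pow U. if S \<inter> A \<noteq> {} \<and> \<not> A \<subseteq> S then \<mu> S * (\<Phi> A - \<Phi> (A - S)) else 0))"
proof -
  define V where "V = {S \<in> Pow U. u \<in> S}"
  have fin: "finite W" "finite V" "finite (Pow W)" using U by (auto simp: W_def V_def)
  have PowU: "Pow U = Pow W \<union> V" "Pow W \<inter> V = {}" using U by (auto simp: W_def V_def)
  have split: "(\<Sum>S\<in>Pow U. f S) = (\<Sum>S\<in>Pow W. f S) + (\<Sum>S\<in>V. f S)" for f :: "'v set \<Rightarrow> real"
    unfolding PowU(1) using fin PowU(2) by (intro sum.union_disjoint) auto
  have h_nonneg: "0 \<le> h A" if "A \<subseteq> W" for A using h_mono[OF that, of "{}"] h0 by simp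
  define B where "B = (\<lambda>A. \<Sum>S\<in>V. \<mu> S * h (A - S))"
  \<comment> \<open>The mass of the cuts in \<open>Pow W\<close> containing all of \<open>A\<close>.
    They do not act on \<open>A\<close>, but complete sums over \<open>Pow W\<close> count
    them.\<close>
  define \<alpha> where "\<alpha> = (\<lambda>A. \<Sum>S\<in>Pow W. if A \<subseteq> S then \<mu> S else 0)"
  have \<alpha>: "0 \<le> \<alpha> A" for A unfolding \<alpha>_def by (intro sum_nonneg) (auto simp: \<mu>)
  have B0: "B {} = 0" by (simp add: B_def h0)
  have B_mono: "B A \<le> B A'" if "A' \<subseteq> W" "A \<subseteq> A'" for A A'
    unfolding B_def using that by (intro sum_mono mult_left_mono h_mono \<mu>) auto
  have B_nonneg: "0 \<le> B A" if "A \<subseteq> W" for A using B_mono[OF that, of "{}"] B0 by simp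
  have eta0: "eta {} = 0" by (simp add: eta_def)
  have eta_ge: "\<alpha> A * h A \<le> eta A" if "A \<subseteq> W" for A
    unfolding eta_def \<alpha>_def sum_distrib_right
  proof (rule sum_mono)
    fix S assume "S \<in> Pow W"
    have "h (A - S) = 0" if "A \<subseteq> S" using that h0 by (simp add: Diff_eq_empty_iff[THEN iffD2])
    then show "(if A \<subseteq> S then \<mu> S else 0) * h A \<le> \<mu> S * (h A - h (A - S))"
      using h_mono[OF that, of "A - S"] \<mu> by auto
  qed
  have eta_nonneg: "0 \<le> eta A" if "A \<subseteq> W" for A
    using eta_ge[OF that] \<alpha>[of A] h_nonneg[OF that] by (meson mult_nonneg_nonneg order_trans)
  \<comment> \<open>Since deletions commute, the sum over \<open>Pow W\<close> can be moved inside
    the sum defining \<open>B\<close>, where it forms \<open>eta (A - S)\<close>.\<close>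
  have LB: "(\<Sum>S\<in>Pow W. \<mu> S * (B A - B (A - S))) = (\<Sum>S\<in>V. \<mu> S * eta (A - S))" for A
  proof -
    have "(\<Sum>S\<in>Pow W. \<mu> S * (B A - B (A - S))) =
        (\<Sum>S\<in>Pow W. \<Sum>S'\<in>V. \<mu> S' * (\<mu> S * (h (A - S') - h (A - S' - S))))"
    proof (rule sum.cong)
      fix S
      have "A - S - S' = A - S' - S" for S' by auto
      then show "\<mu> S * (B A - B (A - S)) = (\<Sum>S'\<in>V. \<mu> S' * (\<mu> S * (h (A - S') - h (A - S' - S))))"
        by (simp add: B_def sum_subtractf[symmetric] sum_distrib_left algebra_simps)
    qed simp
    also have "\<dots> = (\<Sum>S\<in>V. \<mu> S * eta (A - S))"
      by (subst sum.swap) (simp add: eta_def sum_distrib_left)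
    finally show ?thesis .
  qed
  define d where "d = (\<Sum>S\<in>V. \<mu> S)"
  have d: "0 \<le> d" by (simp add: d_def sum_nonneg \<mu>)
  define \<Phi> where "\<Phi> = (\<lambda>A. if u \<in> A then d + B (A - {u}) else d + eta A + B A)"
  have W: "A \<subseteq> U \<Longrightarrow> u \<notin> A \<Longrightarrow> A \<subseteq> W" "A \<subseteq> U \<Longrightarrow> A - {u} \<subseteq> W" for A by (auto simp: W_def)
  show ?thesis
  proof (intro exI[of _ \<Phi>] conjI allI impI ballI)
    fix A assume "A \<subseteq> U"
    then show "0 \<le> \<Phi> A"
      using d B_nonneg eta_nonneg W[of A] by (auto simp: \<Phi>_def intro!: add_nonneg_nonneg)
  next
    fix v assume v: "v \<in> U"
    have dv: "(\<Sum>S | S \<in> Pow U \<and> v \<in> S. \<mu> S) = (\<Sum>S\<in>Pow W. if v \<in> S then \<mu> S else 0) + (\<Sum>S\<in>V. if v \<in> S then \<mu> S else 0)"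
      using U split[of "\<lambda>S. if v \<in> S then \<mu> S else 0"]
      by (subst sum.inter_filter) auto
    have le_d: "(\<Sum>S\<in>V. if v \<in> S then \<mu> S else 0) \<le> d"
      unfolding d_def by (intro sum_mono) (simp add: \<mu>)
    show "(\<Sum>S | S \<in> Pow U \<and> v \<in> S. \<mu> S) \<le> \<Phi> {v}"
    proof (cases "v = u")
      case True
      have "(\<Sum>S\<in>Pow W. if v \<in> S then \<mu> S else 0) = 0"
        using True by (intro sum.neutral) (auto simp: W_def)
      then show ?thesis using dv le_d True by (simp add: \<Phi>_def B0)
    next
      case False
      then have vW: "v \<in> W" using v by (simp add: W_def)
      \<comment> \<open>\<open>h_single\<close> needs a cut of positive mass containing
        \<open>v\<close>; otherwise \<open>\<alpha> {v} = 0\<close> and there is nothing to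
        show.\<close>
      have "\<alpha> {v} = (\<Sum>S | S \<in> Pow W \<and> v \<in> S. \<mu> S)"
        using fin(3) by (subst sum.inter_filter) (auto simp: \<alpha>_def)
      then have "\<alpha> {v} \<le> \<alpha> {v} * h {v}"
        using h_single[OF vW] \<alpha>[of "{v}"] by (cases "\<alpha> {v} = 0") auto
      also have "\<dots> \<le> eta {v}" using eta_ge[of "{v}"] vW by simp
      finally have "(\<Sum>S\<in>Pow W. if v \<in> S then \<mu> S else 0) \<le> eta {v}" by (simp add: \<alpha>_def)
      with dv le_d B_nonneg[of "{v}"] vW False show ?thesis by (simp add: \<Phi>_def)
    qed
  next
    \<comment> \<open>Initially \<open>\<Phi> U = d + B W\<close>; the index
      \<open>card U - 1\<close> is the size of \<open>W\<close>, as \<open>u\<close> itself is not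
      counted.\<close>
    have "B W \<le> (\<Sum>S\<in>V. \<mu> S * harm (card U - 1))"
      unfolding B_def
    proof (intro sum_mono mult_left_mono \<mu>)
      fix S assume "S \<in> V"
      have "h (W - S) \<le> harm (card (W - S))" by (rule h_harm) auto
      also have "card (W - S) \<le> card W" using fin by (intro card_mono) auto
      then have "harm (card (W - S)) \<le> (harm (card W) :: real)" by (rule harm_mono)
      finally show "h (W - S) \<le> harm (card U - 1)" using U by (simp add: W_def)
    qed
    also have "\<dots> = harm (card U - 1) * d" unfolding d_def sum_distrib_right[symmetric] by (rule mult.commute)
    finally have "\<Phi> U \<le> d + harm (card U - 1) * d" using U by (simp add: \<Phi>_def W_def)
    also have "\<dots> = (1 + harm (card U - 1)) * (\<Sum>S | S \<in> Pow U \<and> u \<in> S. \<mu> S)"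
      by (simp add: d_def V_def algebra_simps)
    finally show "\<Phi> U \<le> (1 + harm (card U - 1)) * (\<Sum>S | S \<in> Pow U \<and> u \<in> S. \<mu> S)" .
  next
    fix A assume A: "A \<subseteq> U" "A \<noteq> {}"
    let ?t = "\<lambda>S. if S \<inter> A \<noteq> {} \<and> \<not> A \<subseteq> S then \<mu> S * (\<Phi> A - \<Phi> (A - S)) else 0"
    have "0 \<le> (\<Sum>S\<in>Pow W. ?t S) + (\<Sum>S\<in>V. ?t S)"
    proof (cases "u \<in> A")
      case True
      let ?P = "A - {u}"
      have PW: "?P \<subseteq> W" using A by (auto simp: W_def)
      have "(\<Sum>S\<in>Pow W. ?t S) = (\<Sum>S\<in>Pow W. \<mu> S * (B ?P - B (?P - S)))"
      proof (rule sum.cong)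
        fix S assume S: "S \<in> Pow W"
        have "A - S - {u} = ?P - S" "u \<in> A - S" using S True by (auto simp: W_def)
        moreover have "S \<inter> A = {} \<Longrightarrow> ?P - S = ?P" by auto
        ultimately show "?t S = \<mu> S * (B ?P - B (?P - S))"
          using True S by (auto simp: \<Phi>_def W_def)
      qed simp
      then have "(\<Sum>S\<in>Pow W. ?t S) = (\<Sum>S\<in>V. \<mu> S * eta (?P - S))" by (simp add: LB)
      \<comment> \<open>Losing \<open>u\<close> adds \<open>eta (?P - S)\<close> while
        \<open>B\<close> can only fall, so the rise is covered by the gain just computed. If
        \<open>A \<subseteq> S\<close> the cut is inert, in agreement with
        \<open>eta {} = 0\<close>.\<close>
      moreover have "(\<Sum>S\<in>V. - (\<mu> S * eta (?P - S))) \<le> (\<Sum>S\<in>V. ?t S)"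
      proof (rule sum_mono)
        fix S assume S: "S \<in> V"
        then have AS: "A - S = ?P - S" "u \<in> S" by (auto simp: V_def)
        have "\<mu> S * B (?P - S) \<le> \<mu> S * B ?P" by (intro mult_left_mono B_mono PW \<mu>) auto
        moreover have "eta (?P - S) = 0" if "A \<subseteq> S"
          using that eta0 by (simp add: Diff_eq_empty_iff[THEN iffD2] subset_trans[OF Diff_subset])
        ultimately show "- (\<mu> S * eta (?P - S)) \<le> ?t S"
          using True AS by (auto simp: \<Phi>_def algebra_simps)
      qed
      ultimately show ?thesis by (simp add: sum_negf)
    next
      case False
      then have AW: "A \<subseteq> W" using A by (auto simp: W_def)
      have AS: "A - S \<subseteq> W" "u \<notin> A - S" for S using AW False by auto
      \<comment> \<open>For \<open>eta\<close> only cuts splitting \<open>A\<close> occur, as in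
        \<open>super\<close>. For \<open>B\<close> the sum is completed to all of
        \<open>Pow W\<close>, and the cuts containing \<open>A\<close> enter with a surplus
        \<open>\<alpha> A * B A\<close>.\<close>
      have "(\<Sum>S\<in>Pow W. ?t S) =
         (\<Sum>S\<in>Pow W. if S \<inter> A \<noteq> {} \<and> \<not> A \<subseteq> S then \<mu> S * (eta A - eta (A - S)) else 0) +
         (\<Sum>S\<in>Pow W. \<mu> S * (B A - B (A - S)) - (if A \<subseteq> S then \<mu> S else 0) * B A)"
        unfolding sum.distrib[symmetric]
      proof (rule sum.cong)
        fix S
        have "S \<inter> A = {} \<Longrightarrow> A - S = A \<and> \<not> A \<subseteq> S" using A by auto
        moreover have "A \<subseteq> S \<Longrightarrow> B (A - S) = 0" using B0 by (simp add: Diff_eq_empty_iff[THEN iffD2])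
        ultimately show "?t S = (if S \<inter> A \<noteq> {} \<and> \<not> A \<subseteq> S then \<mu> S * (eta A - eta (A - S)) else 0) +
           (\<mu> S * (B A - B (A - S)) - (if A \<subseteq> S then \<mu> S else 0) * B A)"
          using False by (auto simp: \<Phi>_def algebra_simps)
      qed simp
      also have "(\<Sum>S\<in>Pow W. \<mu> S * (B A - B (A - S)) - (if A \<subseteq> S then \<mu> S else 0) * B A) =
          (\<Sum>S\<in>V. \<mu> S * eta (A - S)) - \<alpha> A * B A"
        by (simp only: sum_subtractf LB \<alpha>_def sum_distrib_right[symmetric])
      finally have 1: "(\<Sum>S\<in>V. \<mu> S * eta (A - S)) - \<alpha> A * B A \<le> (\<Sum>S\<in>Pow W. ?t S)"
        using super[OF AW] by simp
      \<comment> \<open>The cuts containing \<open>u\<close> repay this surplus: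
        \<open>eta A\<close> is at least \<open>\<alpha> A * h (A - S)\<close>, and
        \<open>\<mu> S * h (A - S)\<close> sums over \<open>V\<close> to \<open>B A\<close>.\<close>
      have "(\<Sum>S\<in>V. \<mu> S * (\<alpha> A * h (A - S)) - \<mu> S * eta (A - S)) \<le> (\<Sum>S\<in>V. ?t S)"
      proof (rule sum_mono)
        fix S assume S: "S \<in> V"
        have hA: "\<alpha> A * h (A - S) \<le> \<alpha> A * h A" by (intro mult_left_mono h_mono AW \<alpha>) auto
        also have "\<dots> \<le> eta A" by (rule eta_ge[OF AW])
        finally have e: "\<mu> S * (\<alpha> A * h (A - S)) \<le> \<mu> S * eta A" by (intro mult_left_mono \<mu>)
        have b: "\<mu> S * B (A - S) \<le> \<mu> S * B A" by (intro mult_left_mono B_mono AW \<mu>) auto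
        consider "A \<subseteq> S" | "S \<inter> A = {}" "A - S = A" "\<not> A \<subseteq> S" | "S \<inter> A \<noteq> {}" "\<not> A \<subseteq> S"
          using A by blast
        then show "\<mu> S * (\<alpha> A * h (A - S)) - \<mu> S * eta (A - S) \<le> ?t S"
        proof cases
          case 1
          then show ?thesis by (simp add: eta0 h0 Diff_eq_empty_iff[THEN iffD2])
        next
          case 2
          then show ?thesis using e by simp
        next
          case 3
          then show ?thesis using e b False by (simp add: \<Phi>_def algebra_simps)
        qed
      qed
      moreover have "(\<Sum>S\<in>V. \<mu> S * (\<alpha> A * h (A - S)) - \<mu> S * eta (A - S)) =
          \<alpha> A * B A - (\<Sum>S\<in>V. \<mu> S * eta (A - S))"
        by (simp add: sum_subtractf B_def sum_distrib_left mult.left_commute)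
      ultimately show ?thesis using 1 by linarith
    qed
    then show "0 \<le> (\<Sum>S\<in>Pow U. ?t S)" by (simp only: split)
  qed
qed

text \<open>Instantiates the clocks: one for each set of positive mass that avoids \<open>u\<close>,
  the set itself being its members.\<close>

lemma cut_potential:
  fixes \<mu> :: "'v set \<Rightarrow> real"
  assumes U: "finite U" "u \<in> U" and \<mu>: "\<And>S. 0 \<le> \<mu> S"
  shows "\<exists>\<Phi>. (\<forall>A\<subseteq>U. 0 \<le> \<Phi> A) \<and>
    (\<forall>v\<in>U. (\<Sum>S | S \<in> Pow U \<and> v \<in> S. \<mu> S) \<le> \<Phi> {v}) \<and>
    \<Phi> U \<le> (1 + harm (card U - 1)) * (\<Sum>S | S \<in> Pow U \<and> u \<in> S. \<mu> S) \<and>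
    (\<forall>A\<subseteq>U. A \<noteq> {} \<longrightarrow> 0 \<le> (\<Sum>S\<in>Pow U. if S \<inter> A \<noteq> {} \<and> \<not> A \<subseteq> S then \<mu> S * (\<Phi> A - \<Phi> (A - S)) else 0))"
proof -
  let ?W = "U - {u}"
  define I where "I = {S \<in> Pow ?W. 0 < \<mu> S}"
  \<comment> \<open>The value 1 only meets the positivity demanded by the locale at every index; all
    sums range over \<open>I\<close>, where \<open>rate\<close> is \<open>\<mu>\<close>.\<close>
  define rate where "rate = (\<lambda>S. if 0 < \<mu> S then \<mu> S else 1)"
  interpret exponential_clocks I rate "\<lambda>S. S"
    using U by unfold_locales (auto simp: I_def rate_def)
  have sum_I: "(\<Sum>S\<in>I. if Q S then rate S * f S else 0) = (\<Sum>S\<in>Pow ?W. if Q S then \<mu> S * f S else 0)" for f Q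
  proof (rule sum.mono_neutral_cong_left)
    show "\<forall>S\<in>Pow ?W - I. (if Q S then \<mu> S * f S else 0) = 0"
      using \<mu> by (auto simp: I_def not_less intro: antisym)
  qed (use U in \<open>auto simp: I_def rate_def\<close>)
  have height_drop: "height_drop A = (\<Sum>S\<in>Pow ?W. \<mu> S * (height A - height (A - S)))" for A
    using sum_I[of "\<lambda>_. True"] by (simp add: height_drop_def)
  have finW: "A \<subseteq> ?W \<Longrightarrow> finite A" for A using U finite_subset by blast
  show ?thesis
  proof (rule potential_of_height[where h = height, OF U \<mu>])
    fix v assume "v \<in> ?W" and pos: "0 < (\<Sum>S | S \<in> Pow ?W \<and> v \<in> S. \<mu> S)"
    have "total_rate v = (\<Sum>S\<in>I. if v \<in> S then rate S * 1 else 0)"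
      unfolding total_rate_def clocks_of_def using fin by (simp add: sum.inter_filter cong: if_cong)
    also have "\<dots> = (\<Sum>S | S \<in> Pow ?W \<and> v \<in> S. \<mu> S)"
      using U unfolding sum_I by (subst sum.inter_filter) (auto cong: if_cong)
    finally show "1 \<le> height {v}" using pos by (intro height_singleton_ge_1) simp
  next
    fix A assume A: "A \<subseteq> ?W"
    have "0 \<le> (\<Sum>S\<in>I. if S \<inter> A \<noteq> {} \<and> \<not> A \<subseteq> S then rate S * (height_drop A - height_drop (A - S)) else 0)"
      using height_drop_superharmonic[OF finW[OF A]] fin by (subst (asm) sum.inter_filter) auto
    then show "0 \<le> (\<Sum>S\<in>Pow ?W. if S \<inter> A \<noteq> {} \<and> \<not> A \<subseteq> S
      then \<mu> S * ((\<Sum>S\<in>Pow ?W. \<mu> S * (height A - height (A - S))) - (\<Sum>S'\<in>Pow ?W. \<mu> S' * (height (A - S) - height (A - S - S')))) else 0)"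
      unfolding sum_I height_drop .
  qed (auto intro: height_mono height_le_harm finW)
qed

section \<open>The random process in the leaf of a point\<close>

definition remove :: "'v set \<Rightarrow> 'v set \<Rightarrow> 'v set"
  where "remove S A = (if S \<inter> A \<noteq> {} \<and> \<not> A \<subseteq> S then A - S else A)"

lemma remove_subset: "remove S A \<subseteq> A"
  by (auto simp: remove_def)

lemma remove_nonempty: "A \<noteq> {} \<Longrightarrow> remove S A \<noteq> {}"
  by (auto simp: remove_def)

primrec alive :: "('c \<Rightarrow> 'v set) \<Rightarrow> 'v set \<Rightarrow> (nat \<Rightarrow> 'c) \<Rightarrow> nat \<Rightarrow> 'v set" where
  "alive \<sigma> A w 0 = A"
| "alive \<sigma> A w (Suc n) = remove (\<sigma> (w n)) (alive \<sigma> A w n)"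

text \<open>Unfolds the recursion at the first cut instead of the last, as needed for conditioning
  on the first cut.\<close>

lemma alive_Suc_shift: "alive \<sigma> A w (Suc n) = alive \<sigma> (remove (\<sigma> (w 0)) A) (\<lambda>i. w (Suc i)) n"
  by (induction n) auto

lemma alive_subset: "alive \<sigma> A w n \<subseteq> A"
proof (induction n)
  case (Suc n)
  then show ?case using subset_trans[OF remove_subset] by simp
qed simp

lemma alive_singleton:
  assumes "alive \<sigma> A w m = {v}" "m \<le> n"
  shows "alive \<sigma> A w n = {v}"
  using assms(2)
proof (induction rule: dec_induct)
  case (step n)
  then show ?case by (auto simp: remove_def)
qed (rule assms(1))

context sequence_space
begin

lemma alive_measurable:
  assumes U: "finite U" and \<sigma>: "\<sigma> \<in> measurable M (count_space (Pow U))" and A: "A \<subseteq> U"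
  shows "(\<lambda>w. alive \<sigma> A w n) \<in> measurable S (count_space (Pow U))"
proof (induction n)
  case 0
  then show ?case using A by simp
next
  case (Suc n)
  show ?case
    unfolding alive.simps
  proof (rule measurable_compose_countable'[OF _ Suc])
    fix B assume "B \<in> Pow U"
    then have "(\<lambda>T. remove T B) \<in> measurable (count_space (Pow U)) (count_space (Pow U))"
      using remove_subset[of _ B] by (auto intro: subset_trans)
    moreover have "(\<lambda>w. w n) \<in> measurable S M"
      by measurable
    from measurable_compose[OF this \<sigma>] have "(\<lambda>w. \<sigma> (w n)) \<in> measurable S (count_space (Pow U))" .
    ultimately show "(\<lambda>w. remove (\<sigma> (w n)) B) \<in> measurable S (count_space (Pow U))"
      by (rule measurable_compose[rotated])
  qed (use U in \<open>simp add: countable_finite\<close>)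
qed

text \<open>A supermartingale bound by conditioning on the first cut: by \<open>PiM_iter\<close> a
  random sequence is one cut followed by an independent sequence of the same law, to which the
  induction hypothesis applies from the reduced, still nonempty set.\<close>

lemma nn_integral_alive_le:
  assumes U: "finite U" and \<sigma>: "\<sigma> \<in> measurable M (count_space (Pow U))"
    and super: "\<And>A. A \<subseteq> U \<Longrightarrow> A \<noteq> {} \<Longrightarrow> (\<integral>\<^sup>+ c. ennreal (\<Phi> (remove (\<sigma> c) A)) \<partial>M) \<le> ennreal (\<Phi> A)"
  shows "A \<subseteq> U \<Longrightarrow> A \<noteq> {} \<Longrightarrow> (\<integral>\<^sup>+ w. ennreal (\<Phi> (alive \<sigma> A w n)) \<partial>S) \<le> ennreal (\<Phi> A)"
proof (induction n arbitrary: A)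
  case 0
  then show ?case using P.emeasure_space_1 by simp
next
  case (Suc n)
  have meas: "(\<lambda>w. ennreal (\<Phi> (alive \<sigma> A w n))) \<in> borel_measurable S" if "A \<subseteq> U" for A n
    by (rule measurable_compose[OF alive_measurable[OF U \<sigma> that]]) simp
  have case_nat: "(\<lambda>(s, w). case_nat s w) \<in> measurable (M \<Otimes>\<^sub>M S) S"
    by measurable
  have comp: "(\<lambda>z. ennreal (\<Phi> (alive \<sigma> A (case z of (s, w) \<Rightarrow> case_nat s w) (Suc n)))) \<in> borel_measurable (M \<Otimes>\<^sub>M S)"
    by (rule measurable_compose[OF case_nat meas[OF Suc.prems(1)]])
  have "(\<integral>\<^sup>+ w. ennreal (\<Phi> (alive \<sigma> A w (Suc n))) \<partial>S) =
      (\<integral>\<^sup>+ w. ennreal (\<Phi> (alive \<sigma> A w (Suc n))) \<partial>distr (M \<Otimes>\<^sub>M S) S (\<lambda>(s, w). case_nat s w))"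
    by (simp only: PiM_iter)
  also have "\<dots> = (\<integral>\<^sup>+ z. ennreal (\<Phi> (alive \<sigma> A (case z of (s, w) \<Rightarrow> case_nat s w) (Suc n))) \<partial>(M \<Otimes>\<^sub>M S))"
    by (rule nn_integral_distr[OF case_nat]) (simp only: measurable_distr_eq1 meas[OF Suc.prems(1)])
  also have "\<dots> = (\<integral>\<^sup>+ c. (\<integral>\<^sup>+ w. ennreal (\<Phi> (alive \<sigma> A (case_nat c w) (Suc n))) \<partial>S) \<partial>M)"
    using P.nn_integral_fst[OF comp] by (simp only: prod.case)
  also have "\<dots> = (\<integral>\<^sup>+ c. (\<integral>\<^sup>+ w. ennreal (\<Phi> (alive \<sigma> (remove (\<sigma> c) A) w n)) \<partial>S) \<partial>M)"
    by (simp only: alive_Suc_shift nat.case)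
  also have "\<dots> \<le> (\<integral>\<^sup>+ c. ennreal (\<Phi> (remove (\<sigma> c) A)) \<partial>M)"
  proof (rule nn_integral_mono)
    fix c
    show "(\<integral>\<^sup>+ w. ennreal (\<Phi> (alive \<sigma> (remove (\<sigma> c) A) w n)) \<partial>S) \<le> ennreal (\<Phi> (remove (\<sigma> c) A))"
      by (rule Suc.IH[OF subset_trans[OF remove_subset Suc.prems(1)] remove_nonempty[OF Suc.prems(2)]])
  qed
  also have "\<dots> \<le> ennreal (\<Phi> A)" by (rule super[OF Suc.prems])
  finally show ?case .
qed

end

section \<open>Laws of maps with finitely many values\<close>

lemma (in finite_measure) nn_integral_finite_range:
  assumes U: "finite V" and \<sigma>: "\<sigma> \<in> measurable M (count_space V)" and g: "\<And>S. S \<in> V \<Longrightarrow> 0 \<le> g S"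
  shows "(\<integral>\<^sup>+ c. ennreal (g (\<sigma> c)) \<partial>M) = ennreal (\<Sum>S\<in>V. measure M (\<sigma> -` {S} \<inter> space M) * g S)"
proof -
  have sets: "\<sigma> -` {S} \<inter> space M \<in> sets M" if "S \<in> V" for S
    by (rule measurable_sets[OF \<sigma>]) (use that in simp)
  have "(\<integral>\<^sup>+ c. ennreal (g (\<sigma> c)) \<partial>M) =
      (\<integral>\<^sup>+ c. (\<Sum>S\<in>V. ennreal (g S) * indicator (\<sigma> -` {S} \<inter> space M) c) \<partial>M)"
  proof (rule nn_integral_cong)
    fix c assume c: "c \<in> space M"
    then have "\<sigma> c \<in> V" using measurable_space[OF \<sigma>] by simp
    moreover have "(\<Sum>S\<in>V. ennreal (g S) * indicator (\<sigma> -` {S} \<inter> space M) c) = (\<Sum>S\<in>V. if S = \<sigma> c then ennreal (g S) else 0)"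
      using c by (intro sum.cong) (auto simp: indicator_def)
    ultimately show "ennreal (g (\<sigma> c)) = (\<Sum>S\<in>V. ennreal (g S) * indicator (\<sigma> -` {S} \<inter> space M) c)"
      using U by (simp only: sum.delta if_True)
  qed
  also have "\<dots> = (\<Sum>S\<in>V. ennreal (g S) * emeasure M (\<sigma> -` {S} \<inter> space M))"
    using sets by (subst nn_integral_sum) (auto simp: nn_integral_cmult_indicator)
  also have "\<dots> = (\<Sum>S\<in>V. ennreal (measure M (\<sigma> -` {S} \<inter> space M) * g S))"
    using g by (intro sum.cong refl) (metis emeasure_eq_measure ennreal_mult mult.commute measure_nonneg)
  also have "\<dots> = ennreal (\<Sum>S\<in>V. measure M (\<sigma> -` {S} \<inter> space M) * g S)"
    by (rule sum_ennreal) (simp add: g)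
  finally show ?thesis .
qed

lemma (in prob_space) sum_measure_finite_range:
  assumes U: "finite V" and \<sigma>: "\<sigma> \<in> measurable M (count_space V)"
  shows "(\<Sum>S | S \<in> V \<and> Q S. measure M (\<sigma> -` {S} \<inter> space M)) = measure M {c \<in> space M. Q (\<sigma> c)}"
proof -
  have sets: "\<sigma> -` {S} \<inter> space M \<in> sets M" if "S \<in> V" for S
    by (rule measurable_sets[OF \<sigma>]) (use that in simp)
  have "{c \<in> space M. Q (\<sigma> c)} = (\<Union>S\<in>{S \<in> V. Q S}. \<sigma> -` {S} \<inter> space M)"
    using measurable_space[OF \<sigma>] by auto
  moreover have "measure M (\<Union>S\<in>{S \<in> V. Q S}. \<sigma> -` {S} \<inter> space M) =
      (\<Sum>S | S \<in> V \<and> Q S. measure M (\<sigma> -` {S} \<inter> space M))"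
    using U sets by (intro finite_measure_finite_Union) (auto simp: disjoint_family_on_def)
  ultimately show ?thesis by (simp only:)
qed

section \<open>The effect of cuts on a threshold tree\<close>

definition cut_off :: "real^'d \<Rightarrow> (real^'d) set \<Rightarrow> 'd::finite \<times> real \<Rightarrow> (real^'d) set"
  where "cut_off x U c = {u \<in> U. (u $ fst c \<le> snd c) \<noteq> (x $ fst c \<le> snd c)}"

text \<open>On whichever side \<open>x\<close> lies, \<open>cut_off x U c\<close> consists of the
  centres on the other side; a separated pair exists iff both sides contain a centre of
  \<open>B\<close>.\<close>

lemma cut_separates_pair_iff:
  "cut_separates_pair U B c \<longleftrightarrow> cut_off x U c \<inter> (B \<inter> U) \<noteq> {} \<and> \<not> B \<inter> U \<subseteq> cut_off x U c"
proof (cases "x $ fst c \<le> snd c")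
  case True
  have *: "(\<exists>u\<in>U \<inter> B. \<exists>v\<in>U \<inter> B. P u \<and> Q v) \<longleftrightarrow> {v \<in> U. Q v} \<inter> (B \<inter> U) \<noteq> {} \<and> \<not> B \<inter> U \<subseteq> {v \<in> U. Q v}"
    if "\<And>v. Q v \<longleftrightarrow> \<not> P v" for P Q :: "(real^'a) \<Rightarrow> bool"
    using that by blast
  from True have "cut_off x U c = {u \<in> U. snd c < u $ fst c}" by (auto simp: cut_off_def)
  then show ?thesis unfolding cut_separates_pair_def by (simp only:) (rule *, rule not_le[symmetric])
next
  case False
  have *: "(\<exists>u\<in>U \<inter> B. \<exists>v\<in>U \<inter> B. P u \<and> Q v) \<longleftrightarrow> {v \<in> U. P v} \<inter> (B \<inter> U) \<noteq> {} \<and> \<not> B \<inter> U \<subseteq> {v \<in> U. P v}"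
    if "\<And>v. Q v \<longleftrightarrow> \<not> P v" for P Q :: "(real^'a) \<Rightarrow> bool"
    using that by blast
  from False have "cut_off x U c = {u \<in> U. u $ fst c \<le> snd c}" by (auto simp: cut_off_def)
  then show ?thesis unfolding cut_separates_pair_def by (simp only:) (rule *, rule not_le[symmetric])
qed

text \<open>Links the algorithm to the abstract process: if the leaf of \<open>x\<close> is split,
  the part on the side of \<open>x\<close> remains, and exactly the centres in
  \<open>cut_off x U c\<close> are lost; other leaves have no influence.\<close>

lemma region_of_refine:
  "region_of (refine U c B T) B x \<inter> U = remove (cut_off x U c) (region_of T B x \<inter> U)"
proof (induction T arbitrary: B)
  case Leaf
  let ?S = "cut_off x U c"
  have iff: "cut_separates_pair U B c \<longleftrightarrow> ?S \<inter> (B \<inter> U) \<noteq> {} \<and> \<not> B \<inter> U \<subseteq> ?S"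
    by (rule cut_separates_pair_iff)
  show ?case
  proof (cases "cut_separates_pair U B c")
    case True
    have "region_of (refine U c B Leaf) B x \<inter> U = B \<inter> U - ?S"
      unfolding refine.simps if_P[OF True] region_of.simps cut_off_def
      by (cases "x $ fst c \<le> snd c") auto
    also have "\<dots> = remove ?S (B \<inter> U)"
      using iffD1[OF iff True] unfolding remove_def by (rule if_P[symmetric])
    finally show ?thesis by simp
  next
    case False
    then have "\<not> (?S \<inter> (B \<inter> U) \<noteq> {} \<and> \<not> B \<inter> U \<subseteq> ?S)" unfolding iff .
    then have "remove ?S (B \<inter> U) = B \<inter> U" unfolding remove_def by (rule if_not_P)
    then show ?thesis unfolding refine.simps if_not_P[OF False] region_of.simps by (rule sym)
  qed
qed simp

lemma region_of_rt_tree: "region_of (rt_tree U w n) UNIV x \<inter> U = alive (cut_off x U) U w n"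
  by (induction n) (auto simp: region_of_refine)

lemma region_of_in_leaf_regions: "region_of T B x \<in> set (leaf_regions T B)"
  by (induction T arbitrary: B) auto

text \<open>One step of the separation argument. A split leaf has a centre on each side, so both
  halves keep one; a leaf that is not split has all its centres on one side already.\<close>

lemma leaf_regions_refine:
  "B' \<in> set (leaf_regions (refine U c B T) B) \<Longrightarrow>
    \<exists>B0\<in>set (leaf_regions T B). B' \<subseteq> B0 \<and> (B0 \<inter> U \<noteq> {} \<longrightarrow> B' \<inter> U \<noteq> {}) \<and>
      (\<forall>u\<in>B' \<inter> U. \<forall>v\<in>B' \<inter> U. (u $ fst c \<le> snd c) = (v $ fst c \<le> snd c))"
proof (induction T arbitrary: B B')
  case Leaf
  show ?case
  proof (cases "cut_separates_pair U B c")
    case True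
    then obtain u v where "u \<in> U \<inter> B" "v \<in> U \<inter> B" "u $ fst c \<le> snd c" "snd c < v $ fst c"
      by (auto simp: cut_separates_pair_def)
    moreover from True Leaf have "B' = B \<inter> {x. x $ fst c \<le> snd c} \<or> B' = B \<inter> {x. snd c < x $ fst c}"
      by simp
    ultimately show ?thesis
      by (intro bexI[of _ B] conjI ballI impI) auto
  next
    case False
    have same: "(u $ fst c \<le> snd c) = (v $ fst c \<le> snd c)" if "u \<in> B \<inter> U" "v \<in> B \<inter> U" for u v
    proof (rule ccontr)
      assume "\<not> ?thesis"
      then consider "u $ fst c \<le> snd c" "snd c < v $ fst c" | "v $ fst c \<le> snd c" "snd c < u $ fst c"
        by (cases "u $ fst c \<le> snd c") (auto simp: not_le)
      then show False
        using False that by cases (auto simp: cut_separates_pair_def)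
    qed
    have B': "B' = B" using False Leaf by simp
    show ?thesis
      unfolding B' by (intro bexI[of _ B] conjI ballI impI order_refl same) (assumption | simp)+
  qed
next
  case (Node i \<theta> l r)
  let ?L = "B \<inter> {x. x $ i \<le> \<theta>}" and ?R = "B \<inter> {x. \<theta> < x $ i}"
  have sub: "set (leaf_regions l ?L) \<subseteq> set (leaf_regions (Node i \<theta> l r) B)"
    "set (leaf_regions r ?R) \<subseteq> set (leaf_regions (Node i \<theta> l r) B)" by auto
  consider "B' \<in> set (leaf_regions (refine U c ?L l) ?L)" | "B' \<in> set (leaf_regions (refine U c ?R r) ?R)"
    using Node.prems by auto
  then show ?case
  proof cases
    case 1
    show ?thesis by (rule bexE[OF Node.IH(1)[OF 1]], rule bexI, assumption, rule subsetD[OF sub(1)])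
  next
    case 2
    show ?thesis by (rule bexE[OF Node.IH(2)[OF 2]], rule bexI, assumption, rule subsetD[OF sub(2)])
  qed
qed

lemma leaf_regions_rt_tree:
  assumes "U \<noteq> {}" "B \<in> set (leaf_regions (rt_tree U w n) UNIV)"
  shows "B \<inter> U \<noteq> {} \<and> (\<forall>u\<in>B \<inter> U. \<forall>v\<in>B \<inter> U. \<forall>j<n. (u $ fst (w j) \<le> snd (w j)) = (v $ fst (w j) \<le> snd (w j)))"
  using assms(2)
proof (induction n arbitrary: B)
  case 0
  then show ?case using assms(1) by simp
next
  case (Suc n)
  then have "B \<in> set (leaf_regions (refine U (w n) UNIV (rt_tree U w n)) UNIV)" by simp
  from leaf_regions_refine[OF this] obtain B0 where
    B0: "B0 \<in> set (leaf_regions (rt_tree U w n) UNIV)" "B \<subseteq> B0" "B0 \<inter> U \<noteq> {} \<longrightarrow> B \<inter> U \<noteq> {}"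
    "\<forall>u\<in>B \<inter> U. \<forall>v\<in>B \<inter> U. (u $ fst (w n) \<le> snd (w n)) = (v $ fst (w n) \<le> snd (w n))"
    by (elim bexE conjE)
  note IH = Suc.IH[OF B0(1)]
  have "(u $ fst (w j) \<le> snd (w j)) = (v $ fst (w j) \<le> snd (w j))"
    if "u \<in> B \<inter> U" "v \<in> B \<inter> U" "j < Suc n" for u v j
  proof (cases "j = n")
    case True
    then show ?thesis using B0(4) that by blast
  next
    case False
    then have "j < n" "u \<in> B0 \<inter> U" "v \<in> B0 \<inter> U" using that B0(2) by auto
    then show ?thesis using IH by blast
  qed
  then show ?case using IH B0(3) by blast
qed

text \<open>Finitely many pairs need finitely many cuts. Once a separating cut for each pair has
  occurred, two centres in one leaf would agree on all of them and hence coincide.\<close>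

lemma separates_rt_tree:
  assumes U: "U \<noteq> {}" "finite U"
    and sep: "\<And>u v. u \<in> U \<Longrightarrow> v \<in> U \<Longrightarrow> u \<noteq> v \<Longrightarrow> \<exists>j. (u $ fst (w j) \<le> snd (w j)) \<noteq> (v $ fst (w j) \<le> snd (w j))"
  shows "\<exists>n. separates (rt_tree U w n) U"
proof -
  obtain j where j: "\<And>u v. u \<in> U \<Longrightarrow> v \<in> U \<Longrightarrow> u \<noteq> v \<Longrightarrow>
      (u $ fst (w (j u v)) \<le> snd (w (j u v))) \<noteq> (v $ fst (w (j u v)) \<le> snd (w (j u v)))"
    using sep by metis
  \<comment> \<open>The successor is needed because the tree after \<open>n\<close> rounds has used
    only the cuts with index below \<open>n\<close>.\<close>
  define n where "n = Suc (Max ((\<lambda>(u, v). j u v) ` (U \<times> U)))"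
  have jn: "j u v < n" if "u \<in> U" "v \<in> U" for u v
    unfolding n_def less_Suc_eq_le using U that by (intro Max_ge) (auto intro!: rev_image_eqI[of "(u, v)"])
  have "card (B \<inter> U) = 1" if B: "B \<in> set (leaf_regions (rt_tree U w n) UNIV)" for B
  proof -
    note l = leaf_regions_rt_tree[OF U(1) B]
    then obtain u where u: "u \<in> B \<inter> U" by auto
    have "v = u" if v: "v \<in> B \<inter> U" for v
    proof (rule ccontr)
      assume "v \<noteq> u"
      then have "u \<noteq> v" by simp
      have "(u $ fst (w (j u v)) \<le> snd (w (j u v))) = (v $ fst (w (j u v)) \<le> snd (w (j u v)))"
        using l[THEN conjunct2, rule_format, OF u v jn[OF IntD2[OF u] IntD2[OF v]]] .
      with j[OF IntD2[OF u] IntD2[OF v] \<open>u \<noteq> v\<close>] show False by (rule notE)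
    qed
    with u have "B \<inter> U = {u}" by blast
    then show ?thesis by simp
  qed
  then show ?thesis unfolding separates_def by blast
qed

section \<open>Separating trees, their leaves and their explainable cost\<close>

lemma separates_tree_assign:
  assumes "separates T U"
  shows "region_of T UNIV x \<inter> U = {tree_assign T U x}"
proof -
  have "card (region_of T UNIV x \<inter> U) = 1"
    using assms region_of_in_leaf_regions by (auto simp: separates_def)
  then obtain v where v: "region_of T UNIV x \<inter> U = {v}" by (auto simp: card_1_singleton_iff)
  then have "(THE c. c \<in> U \<and> c \<in> region_of T UNIV x) = v" by (intro the_equality) auto
  with v show ?thesis by (simp add: tree_assign_def)
qed

lemma sum_list_card_leaf_regions:
  assumes "finite U"
  shows "(\<Sum>B'\<leftarrow>leaf_regions T B. card (B' \<inter> U)) = card (B \<inter> U)"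
proof (induction T arbitrary: B)
  case (Node i \<theta> l r)
  have "B \<inter> U = (B \<inter> {x. x $ i \<le> \<theta>} \<inter> U) \<union> (B \<inter> {x. \<theta> < x $ i} \<inter> U)" by auto
  then have "card (B \<inter> U) = card (B \<inter> {x. x $ i \<le> \<theta>} \<inter> U) + card (B \<inter> {x. \<theta> < x $ i} \<inter> U)"
    using card_Un_disjoint[of "B \<inter> {x. x $ i \<le> \<theta>} \<inter> U" "B \<inter> {x. \<theta> < x $ i} \<inter> U"] assms by force
  then show ?case using Node by simp
qed simp

text \<open>The leaves partition the space, so their numbers of centres add up to
  \<open>card U\<close>, and each of these numbers is 1.\<close>

lemma separates_num_leaves:
  assumes "finite U" "separates T U"
  shows "num_leaves T = card U"
proof -
  have "(\<Sum>B\<leftarrow>leaf_regions T UNIV. card (B \<inter> U)) = (\<Sum>B\<leftarrow>leaf_regions T UNIV. 1)"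
    using assms(2) by (intro arg_cong[where f=sum_list] map_cong) (auto simp: separates_def)
  then show ?thesis
    using sum_list_card_leaf_regions[OF assms(1), of T UNIV] by (simp add: num_leaves_def sum_list_triv)
qed

lemma l1dist_nonneg: "0 \<le> l1dist x y"
  by (simp add: l1dist_def sum_nonneg)

lemma cluster_cost_nonneg: "0 \<le> cluster_cost C"
  unfolding cluster_cost_def by (intro cINF_greatest) (auto intro!: sum_nonneg l1dist_nonneg)

lemma cluster_cost_le: "cluster_cost C \<le> (\<Sum>x\<in>C. l1dist x c)"
  unfolding cluster_cost_def
  by (intro cINF_lower bdd_belowI2[where m=0]) (auto intro!: sum_nonneg l1dist_nonneg)

text \<open>\<open>g\<close> proposes one centre per leaf, which bounds the optimal cost of that
  cluster. As \<open>g\<close> sees only the region, the induction passes it unchanged to both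
  subtrees.\<close>

lemma sum_list_cluster_cost_le:
  assumes "finite X"
  shows "(\<Sum>B'\<leftarrow>leaf_regions T B. cluster_cost (X \<inter> B')) \<le> (\<Sum>x\<in>X \<inter> B. l1dist x (g (region_of T B x)))"
proof (induction T arbitrary: B)
  case Leaf
  then show ?case using cluster_cost_le[of "X \<inter> B" "g B"] by simp
next
  case (Node i \<theta> l r)
  let ?L = "B \<inter> {x. x $ i \<le> \<theta>}" and ?R = "B \<inter> {x. \<theta> < x $ i}" and ?T = "Node i \<theta> l r"
  have XB: "X \<inter> B = (X \<inter> ?L) \<union> (X \<inter> ?R)" by auto
  have "(\<Sum>x\<in>X \<inter> B. l1dist x (g (region_of ?T B x))) =
      (\<Sum>x\<in>X \<inter> ?L. l1dist x (g (region_of ?T B x))) + (\<Sum>x\<in>X \<inter> ?R. l1dist x (g (region_of ?T B x)))"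
    using assms by (subst (1) XB) (intro sum.union_disjoint; auto)
  also have "(\<Sum>x\<in>X \<inter> ?L. l1dist x (g (region_of ?T B x))) = (\<Sum>x\<in>X \<inter> ?L. l1dist x (g (region_of l ?L x)))"
    by (intro sum.cong) auto
  also have "(\<Sum>x\<in>X \<inter> ?R. l1dist x (g (region_of ?T B x))) = (\<Sum>x\<in>X \<inter> ?R. l1dist x (g (region_of r ?R x)))"
    by (intro sum.cong) auto
  finally show ?case using Node[of ?L] Node[of ?R] by simp
qed

lemma expl_cost_nonneg: "0 \<le> expl_cost X T"
  unfolding expl_cost_def by (intro sum_list_nonneg) (auto simp: cluster_cost_nonneg)

lemma expl_cost_le_tree_cost1: "finite X \<Longrightarrow> expl_cost X T \<le> tree_cost1 X U T"
  using sum_list_cluster_cost_le[of X T UNIV "\<lambda>B. THE c. c \<in> U \<and> c \<in> B"]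
  by (simp add: expl_cost_def tree_cost1_def cost1_def tree_assign_def)

lemma expl_opt_le: "num_leaves T = k \<Longrightarrow> expl_opt k X \<le> expl_cost X T"
  unfolding expl_opt_def by (intro cINF_lower bdd_belowI2[where m=0]) (auto simp: expl_cost_nonneg)

section \<open>Cost of the random tree\<close>

lemma prob_space_cut_measure:
  fixes a b :: real
  assumes "a < b"
  shows "prob_space (cut_measure a b :: ('d::finite \<times> real) measure)"
proof -
  have "prob_space (uniform_measure lborel {a..b})"
    using assms by (intro prob_space_uniform_measure) auto
  then show ?thesis
    unfolding cut_measure_def by (intro prob_space_pair prob_space_measure_pmf)
qed

lemma space_cut_measure [simp]: "space (cut_measure a b) = UNIV"
  by (simp add: cut_measure_def space_pair_measure)

lemma sets_cut_le: "{c. u $ fst c \<le> snd c} \<in> sets (cut_measure a b :: ('d::finite \<times> real) measure)"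
proof -
  have "{c. u $ fst c \<le> snd c} = (\<Union>i::'d. {i} \<times> {u $ i..})" by auto
  also have "\<dots> \<in> sets (cut_measure a b)"
    unfolding cut_measure_def by (intro sets.finite_UN pair_measureI) auto
  finally show ?thesis .
qed

lemma sets_cut_neq: "{c. (u $ fst c \<le> snd c) \<noteq> (x $ fst c \<le> snd c)} \<in> sets (cut_measure a b :: ('d::finite \<times> real) measure)"
proof -
  let ?A = "\<lambda>u. {c. u $ fst c \<le> snd c} :: ('d \<times> real) set"
  have "{c. (u $ fst c \<le> snd c) \<noteq> (x $ fst c \<le> snd c)} = (?A u - ?A x) \<union> (?A x - ?A u)"
    by auto
  also have "\<dots> \<in> sets (cut_measure a b)"
    by (intro sets.Un sets.Diff sets_cut_le)
  finally show ?thesis .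
qed

lemma cut_off_measurable:
  assumes "finite U"
  shows "cut_off x U \<in> measurable (cut_measure a b) (count_space (Pow U))"
proof -
  have "cut_off x U -` {S} \<inter> space (cut_measure a b) \<in> sets (cut_measure a b)" if "S \<subseteq> U" for S
  proof -
    let ?P = "\<lambda>u c. (u $ fst c \<le> snd c) \<noteq> (x $ fst c \<le> snd c)"
    have *: "(\<lambda>c. {u \<in> U. P u c}) -` {S} \<inter> A =
        {c \<in> A. \<forall>u\<in>U. c \<in> (if u \<in> S then Collect (P u) else UNIV - Collect (P u))}" for P :: "_ \<Rightarrow> _ \<Rightarrow> bool" and A
      using that by auto
    have "cut_off x U -` {S} \<inter> space (cut_measure a b) =
        {c \<in> space (cut_measure a b). \<forall>u\<in>U. c \<in> (if u \<in> S then Collect (?P u) else UNIV - Collect (?P u))}"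
      unfolding cut_off_def by (rule *)
    also have "\<dots> \<in> sets (cut_measure a b)"
    proof (rule sets.sets_Collect_finite_All[OF _ assms])
      fix u
      show "{c \<in> space (cut_measure a b). c \<in> (if u \<in> S then Collect (?P u) else UNIV - Collect (?P u))} \<in> sets (cut_measure a b)"
        using sets_cut_neq[of u x a b] sets.compl_sets[OF sets_cut_neq[of u x a b]] by (cases "u \<in> S") (simp_all only: if_True if_False space_cut_measure mem_Collect_eq simp_thms Collect_mem_eq UNIV_I)
    qed
    finally show ?thesis .
  qed
  then show ?thesis
    using assms by (subst measurable_count_space_eq2) (auto simp only: cut_off_def Pow_iff finite_Pow_iff)
qed

text \<open>Along coordinate \<open>i\<close> the separating thresholds form a half-open interval of
  length \<open>\<bar>x $ i - u $ i\<bar>\<close>, contained in \<open>{a..b}\<close> by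
  \<open>box\<close>; the result averages over the coordinates.\<close>

lemma measure_cut_neq:
  fixes u x :: "real^'d::finite" and a b :: real
  assumes ab: "a < b" and box: "\<And>i. a \<le> u $ i \<and> u $ i \<le> b" "\<And>i. a \<le> x $ i \<and> x $ i \<le> b"
  shows "measure (cut_measure a b) {c. (u $ fst c \<le> snd c) \<noteq> (x $ fst c \<le> snd c)} =
    l1dist x u / (CARD('d) * (b - a))"
proof -
  let ?X = "{c. (u $ fst c \<le> snd c) \<noteq> (x $ fst c \<le> snd c)} :: ('d \<times> real) set"
  let ?N = "uniform_measure lborel {a..b}"
  interpret N: prob_space ?N
    using ab by (intro prob_space_uniform_measure) auto
  have slice: "emeasure ?N (Pair i -` ?X) = ennreal (\<bar>x $ i - u $ i\<bar> / (b - a))" for i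
  proof -
    have eq: "Pair i -` ?X = {min (u $ i) (x $ i)..<max (u $ i) (x $ i)}" by auto
    have "{a..b} \<inter> {min (u $ i) (x $ i)..<max (u $ i) (x $ i)} = {min (u $ i) (x $ i)..<max (u $ i) (x $ i)}"
      using box(1)[of i] box(2)[of i] by auto
    then have "emeasure ?N (Pair i -` ?X) = emeasure lborel {min (u $ i) (x $ i)..<max (u $ i) (x $ i)} / emeasure lborel {a..b}"
      unfolding eq by (subst emeasure_uniform_measure) auto
    also have "\<dots> = ennreal \<bar>x $ i - u $ i\<bar> / ennreal (b - a)"
      using ab by (auto simp: max_def min_def)
    also have "\<dots> = ennreal (\<bar>x $ i - u $ i\<bar> / (b - a))"
      using ab by (simp add: divide_ennreal)
    finally show ?thesis .
  qed
  have "emeasure (cut_measure a b) ?X = (\<integral>\<^sup>+ i. emeasure ?N (Pair i -` ?X) \<partial>measure_pmf (pmf_of_set UNIV))"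
    using sets_cut_neq[of u x a b] unfolding cut_measure_def by (rule N.emeasure_pair_measure_alt)
  also have "\<dots> = (\<Sum>i\<in>UNIV. ennreal (\<bar>x $ i - u $ i\<bar> / (b - a))) / ennreal (CARD('d))"
    by (simp only: slice) (subst nn_integral_pmf_of_set, auto simp: ennreal_of_nat_eq_real_of_nat)
  also have "(\<Sum>i\<in>UNIV. ennreal (\<bar>x $ i - u $ i\<bar> / (b - a))) = ennreal (l1dist x u / (b - a))"
    using ab by (simp add: l1dist_def sum_divide_distrib)
  also have "ennreal (l1dist x u / (b - a)) / ennreal (CARD('d)) = ennreal (l1dist x u / (CARD('d) * (b - a)))"
    using ab l1dist_nonneg[of x u] by (subst divide_ennreal) (auto simp: mult.commute)
  finally show ?thesis
    using ab l1dist_nonneg[of x u] by (simp add: measure_def)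
qed

text \<open>Applies \<open>cut_potential\<close> to the law of \<open>cut_off x U\<close> and
  rescales the potential from probabilities to distances.\<close>

lemma alive_potential:
  fixes x u :: "real^'d::finite" and a b :: real
  assumes ab: "a < b" and U: "finite U" "u \<in> U"
    and box: "\<And>p i. p \<in> insert x U \<Longrightarrow> a \<le> p $ i \<and> p $ i \<le> b"
  shows "\<exists>\<Psi>. (\<forall>v\<in>U. l1dist x v \<le> \<Psi> {v}) \<and>
    (\<forall>n. (\<integral>\<^sup>+ w. ennreal (\<Psi> (alive (cut_off x U) U w n)) \<partial>cut_seq_space a b)
      \<le> ennreal ((1 + harm (card U - 1)) * l1dist x u))"
proof -
  let ?M = "cut_measure a b :: ('d \<times> real) measure" and ?s = "cut_off x U"
  interpret M: prob_space ?M by (rule prob_space_cut_measure[OF ab])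
  interpret sequence_space ?M ..
  note s = cut_off_measurable[OF U(1), of x a b]
  \<comment> \<open>The normalising factor of \<open>measure_cut_neq\<close>: a cut separates
    \<open>v\<close> from \<open>x\<close> with probability \<open>l1dist x v / D\<close>.\<close>
  define D where "D = CARD('d) * (b - a)"
  have D: "0 < D" using ab by (simp add: D_def)
  define \<mu> where "\<mu> = (\<lambda>S. measure ?M (?s -` {S} \<inter> space ?M))"
  have \<mu>: "0 \<le> \<mu> S" for S by (simp add: \<mu>_def)
  have d: "(\<Sum>S | S \<in> Pow U \<and> v \<in> S. \<mu> S) = l1dist x v / D" if v: "v \<in> U" for v
  proof -
    have "(\<Sum>S | S \<in> Pow U \<and> v \<in> S. \<mu> S) = measure ?M {c \<in> space ?M. v \<in> ?s c}"
      unfolding \<mu>_def using U s by (intro M.sum_measure_finite_range) auto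
    also have "{c \<in> space ?M. v \<in> ?s c} = {c. (v $ fst c \<le> snd c) \<noteq> (x $ fst c \<le> snd c)}"
      using v by (auto simp: cut_off_def)
    also have "measure ?M \<dots> = l1dist x v / D"
      unfolding D_def by (rule measure_cut_neq[OF ab box box]) (use v in simp_all)
    finally show ?thesis .
  qed
  have one: "(\<Sum>S\<in>Pow U. \<mu> S) = 1"
    using M.sum_measure_finite_range[OF _ s, of "\<lambda>_. True"] U M.prob_space by (simp add: \<mu>_def Pow_def)
  obtain \<Phi> where \<Phi>: "\<And>A. A \<subseteq> U \<Longrightarrow> 0 \<le> \<Phi> A"
    "\<And>v. v \<in> U \<Longrightarrow> l1dist x v / D \<le> \<Phi> {v}"
    "\<Phi> U \<le> (1 + harm (card U - 1)) * (l1dist x u / D)"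
    "\<And>A. A \<subseteq> U \<Longrightarrow> A \<noteq> {} \<Longrightarrow> 0 \<le> (\<Sum>S\<in>Pow U. if S \<inter> A \<noteq> {} \<and> \<not> A \<subseteq> S then \<mu> S * (\<Phi> A - \<Phi> (A - S)) else 0)"
    using cut_potential[where \<mu> = \<mu>, OF U \<mu>] d U(2) by auto
  define \<Psi> where "\<Psi> = (\<lambda>A. D * \<Phi> A)"
  have super: "(\<integral>\<^sup>+ c. ennreal (\<Psi> (remove (?s c) A)) \<partial>?M) \<le> ennreal (\<Psi> A)" if A: "A \<subseteq> U" "A \<noteq> {}" for A
  proof -
    have "(\<integral>\<^sup>+ c. ennreal (\<Psi> (remove (?s c) A)) \<partial>?M) = ennreal (\<Sum>S\<in>Pow U. \<mu> S * \<Psi> (remove S A))"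
      unfolding \<mu>_def
    proof (rule M.nn_integral_finite_range[OF _ s, of "\<lambda>S. \<Psi> (remove S A)"])
      show "0 \<le> \<Psi> (remove S A)" for S
        unfolding \<Psi>_def using D \<Phi>(1)[OF subset_trans[OF remove_subset A(1)]] by simp
    qed (use U in simp)
    also have "\<dots> \<le> ennreal (\<Psi> A)"
    proof (rule ennreal_leI)
      have "0 \<le> (\<Sum>S\<in>Pow U. \<mu> S * (\<Phi> A - \<Phi> (remove S A)))"
        using \<Phi>(4)[OF A] by (rule order_trans) (auto intro!: sum_mono simp: remove_def)
      also have "\<dots> = \<Phi> A - (\<Sum>S\<in>Pow U. \<mu> S * \<Phi> (remove S A))"
        using one by (simp add: right_diff_distrib sum_subtractf sum_distrib_right[symmetric])
      finally have "D * (\<Sum>S\<in>Pow U. \<mu> S * \<Phi> (remove S A)) \<le> D * \<Phi> A"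
        using D by simp
      then show "(\<Sum>S\<in>Pow U. \<mu> S * \<Psi> (remove S A)) \<le> \<Psi> A"
        by (simp add: \<Psi>_def sum_distrib_left mult.left_commute)
    qed
    finally show ?thesis .
  qed
  show ?thesis
  proof (intro exI[of _ \<Psi>] conjI ballI allI)
    fix v assume "v \<in> U"
    then show "l1dist x v \<le> \<Psi> {v}" using \<Phi>(2) D by (simp add: \<Psi>_def field_simps)
  next
    fix n
    have "(\<integral>\<^sup>+ w. ennreal (\<Psi> (alive ?s U w n)) \<partial>S) \<le> ennreal (\<Psi> U)"
      using U by (intro nn_integral_alive_le[OF U(1) s super]) auto
    also have "\<dots> \<le> ennreal ((1 + harm (card U - 1)) * l1dist x u)"
      using \<Phi>(3) D by (intro ennreal_leI) (simp add: \<Psi>_def field_simps)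
    finally show "(\<integral>\<^sup>+ w. ennreal (\<Psi> (alive ?s U w n)) \<partial>cut_seq_space a b)
      \<le> ennreal ((1 + harm (card U - 1)) * l1dist x u)"
      by (simp add: cut_seq_space_def)
  qed
qed

text \<open>Distinct centres have positive distance, so each round separates a given pair with a
  fixed positive probability and failure forever has probability 0; there are finitely many
  pairs.\<close>

lemma AE_separates:
  fixes U :: "(real^'d::finite) set" and a b :: real
  assumes ab: "a < b" and U: "finite U" "U \<noteq> {}" and box: "\<And>p i. p \<in> U \<Longrightarrow> a \<le> p $ i \<and> p $ i \<le> b"
  shows "AE w in cut_seq_space a b. \<exists>n. separates (rt_tree U w n) U"
proof -
  let ?M = "cut_measure a b :: ('d \<times> real) measure"
  interpret M: prob_space ?M by (rule prob_space_cut_measure[OF ab])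
  interpret sequence_space ?M ..
  have pair: "AE w in S. \<exists>j. (u $ fst (w j) \<le> snd (w j)) \<noteq> (v $ fst (w j) \<le> snd (w j))"
    if uv: "u \<in> U" "v \<in> U" "u \<noteq> v" for u v
  proof -
    let ?X = "{c. (u $ fst c \<le> snd c) \<noteq> (v $ fst c \<le> snd c)}"
    have X: "?X \<in> sets ?M" by (rule sets_cut_neq)
    obtain i where i: "u $ i \<noteq> v $ i" using uv by (auto simp: vec_eq_iff)
    have "0 < \<bar>v $ i - u $ i\<bar>" using i by simp
    also have "\<dots> \<le> l1dist v u" unfolding l1dist_def by (rule member_le_sum) auto
    finally have "0 < measure ?M ?X"
      using measure_cut_neq[OF ab, of u v] box uv ab by simp
    then have lt: "measure ?M (UNIV - ?X) < 1"
      using M.prob_compl[OF X] by simp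
    have Y: "UNIV - ?X \<in> sets ?M" using sets.compl_sets[OF X] by simp
    \<comment> \<open>The exponent is \<open>Suc n\<close> because the partial products run over
      \<open>{..n}\<close>.\<close>
    have "(\<lambda>n. measure ?M (UNIV - ?X) ^ Suc n) \<longlonglongrightarrow> measure S (Pi UNIV (\<lambda>_. UNIV - ?X))"
      using measure_PiM_countable[of "\<lambda>_. UNIV - ?X", OF Y] by (simp add: prod_constant)
    moreover have "(\<lambda>n. measure ?M (UNIV - ?X) ^ Suc n) \<longlonglongrightarrow> 0"
      using lt by (intro LIMSEQ_Suc LIMSEQ_realpow_zero) auto
    ultimately have "measure S (Pi UNIV (\<lambda>_. UNIV - ?X)) = 0"
      by (rule LIMSEQ_unique)
    then have "Pi UNIV (\<lambda>_. UNIV - ?X) \<in> null_sets S"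
      using infprod_in_sets[of "\<lambda>_. UNIV - ?X", OF Y] by (simp add: null_sets_def P.emeasure_eq_measure)
    then show ?thesis
    proof (rule AE_I', intro subsetI Pi_I DiffI UNIV_I notI)
      fix w j
      assume "w \<in> {w \<in> space S. \<not> (\<exists>j. (u $ fst (w j) \<le> snd (w j)) \<noteq> (v $ fst (w j) \<le> snd (w j)))}"
        and "w j \<in> ?X"
      then show False by (simp only: mem_Collect_eq) blast
    qed
  qed
  have "AE w in S. \<forall>u\<in>U. \<forall>v\<in>U. u \<noteq> v \<longrightarrow> (\<exists>j. (u $ fst (w j) \<le> snd (w j)) \<noteq> (v $ fst (w j) \<le> snd (w j)))"
    using U pair by (intro AE_finite_allI) auto
  then have "AE w in S. \<exists>n. separates (rt_tree U w n) U"
    by eventually_elim (rule separates_rt_tree[OF U(2,1)], blast)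
  then show ?thesis unfolding cut_seq_space_def .
qed

lemma rt_output_eq: "\<exists>n. separates (rt_tree U w n) U \<Longrightarrow> \<exists>n. rt_output U w = rt_tree U w n \<and> separates (rt_tree U w n) U"
  by (auto simp: rt_output_def intro: LeastI)

text \<open>The stopping time is random, whereas the potential is controlled at each fixed time.
  After separation every alive set stays the same singleton, so the output cost is bounded by a
  liminf of potentials, and Fatou transfers the bound.\<close>

lemma expected_tree_cost:
  fixes X U :: "(real^'d::finite) set" and a b :: real
  assumes X: "finite X" and U: "finite U" "U \<noteq> {}" and \<pi>: "\<And>x. x \<in> X \<Longrightarrow> \<pi> x \<in> U"
    and ab: "a < b" and box: "\<And>p i. p \<in> X \<union> U \<Longrightarrow> a \<le> p $ i \<and> p $ i \<le> b"
  shows "(\<integral>\<^sup>+ w. ennreal (tree_cost1 X U (rt_output U w)) \<partial>cut_seq_space a b)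
    \<le> ennreal ((1 + harm (card U - 1)) * cost1 X \<pi>)"
proof -
  let ?M = "cut_measure a b :: ('d \<times> real) measure" and ?H = "1 + harm (card U - 1) :: real"
  interpret M: prob_space ?M by (rule prob_space_cut_measure[OF ab])
  interpret sequence_space ?M ..
  have S: "cut_seq_space a b = S" by (simp add: cut_seq_space_def)
  have "\<exists>\<Psi>. (\<forall>v\<in>U. l1dist x v \<le> \<Psi> {v}) \<and>
      (\<forall>n. (\<integral>\<^sup>+ w. ennreal (\<Psi> (alive (cut_off x U) U w n)) \<partial>S) \<le> ennreal (?H * l1dist x (\<pi> x)))" if "x \<in> X" for x
    using alive_potential[OF ab U(1) \<pi>[OF that], of x] box that unfolding S by auto
  then obtain \<Psi> where \<Psi>: "\<And>x v. x \<in> X \<Longrightarrow> v \<in> U \<Longrightarrow> l1dist x v \<le> \<Psi> x {v}"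
    "\<And>x n. x \<in> X \<Longrightarrow> (\<integral>\<^sup>+ w. ennreal (\<Psi> x (alive (cut_off x U) U w n)) \<partial>S) \<le> ennreal (?H * l1dist x (\<pi> x))"
    by metis
  define g where "g = (\<lambda>x w. liminf (\<lambda>n. ennreal (\<Psi> x (alive (cut_off x U) U w n))))"
  have meas: "(\<lambda>w. ennreal (\<Psi> x (alive (cut_off x U) U w n))) \<in> borel_measurable S" for x n
    by (rule measurable_compose[OF alive_measurable[OF U(1) cut_off_measurable[OF U(1)] subset_refl]]) simp
  have g_meas [measurable]: "g x \<in> borel_measurable S" for x
    unfolding g_def using meas by measurable
  have g_le: "(\<integral>\<^sup>+ w. g x w \<partial>S) \<le> ennreal (?H * l1dist x (\<pi> x))" if "x \<in> X" for x
  proof -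
    have "(\<integral>\<^sup>+ w. g x w \<partial>S) \<le> liminf (\<lambda>n. \<integral>\<^sup>+ w. ennreal (\<Psi> x (alive (cut_off x U) U w n)) \<partial>S)"
      unfolding g_def by (rule nn_integral_liminf[OF meas])
    also have "\<dots> \<le> liminf (\<lambda>n::nat. ennreal (?H * l1dist x (\<pi> x)))"
      using \<Psi>(2)[OF that] by (intro Liminf_mono always_eventually) auto
    finally show ?thesis by (simp add: Liminf_const)
  qed
  have sep: "AE w in S. \<exists>n. separates (rt_tree U w n) U"
    unfolding S[symmetric] by (rule AE_separates[OF ab U]) (simp add: box)
  have "AE w in S. ennreal (tree_cost1 X U (rt_output U w)) \<le> (\<Sum>x\<in>X. g x w)"
    using sep
  proof eventually_elim
    case (elim w)
    then obtain m where m: "rt_output U w = rt_tree U w m" "separates (rt_tree U w m) U"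
      using rt_output_eq by blast
    have "ennreal (l1dist x (tree_assign (rt_tree U w m) U x)) \<le> g x w" if x: "x \<in> X" for x
    proof -
      let ?v = "tree_assign (rt_tree U w m) U x"
      have v: "alive (cut_off x U) U w m = {?v}"
        using separates_tree_assign[OF m(2), of x] by (simp add: region_of_rt_tree)
      then have "?v \<in> U" using alive_subset[of "cut_off x U" U w m] by auto
      then have "ennreal (l1dist x ?v) \<le> ennreal (\<Psi> x (alive (cut_off x U) U w n))" if "m \<le> n" for n
        using \<Psi>(1)[OF x] alive_singleton[OF v that] by (simp add: ennreal_leI)
      then show ?thesis
        unfolding g_def by (intro Liminf_bounded) (auto simp: eventually_sequentially)
    qed
    then have "(\<Sum>x\<in>X. ennreal (l1dist x (tree_assign (rt_tree U w m) U x))) \<le> (\<Sum>x\<in>X. g x w)"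
      by (intro sum_mono)
    then show ?case
      by (simp add: tree_cost1_def cost1_def m(1) l1dist_nonneg)
  qed
  then have "(\<integral>\<^sup>+ w. ennreal (tree_cost1 X U (rt_output U w)) \<partial>S) \<le> (\<integral>\<^sup>+ w. (\<Sum>x\<in>X. g x w) \<partial>S)"
    by (rule nn_integral_mono_AE)
  also have "\<dots> = (\<Sum>x\<in>X. \<integral>\<^sup>+ w. g x w \<partial>S)"
    by (rule nn_integral_sum) simp
  also have "\<dots> \<le> (\<Sum>x\<in>X. ennreal (?H * l1dist x (\<pi> x)))"
    by (intro sum_mono g_le)
  also have "\<dots> = ennreal (?H * cost1 X \<pi>)"
    by (subst sum_ennreal) (auto simp: cost1_def sum_distrib_left harm_nonneg l1dist_nonneg)
  finally show ?thesis by (simp add: S)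
qed

section \<open>From the expected cost to the price of explainability\<close>

lemma cost1_nonneg: "0 \<le> cost1 X \<pi>"
  by (simp add: cost1_def sum_nonneg l1dist_nonneg)

lemma bounding_box:
  fixes P :: "(real^'d::finite) set"
  assumes "finite P"
  shows "\<exists>a b :: real. a < b \<and> (\<forall>p\<in>P. \<forall>i. a \<le> p $ i \<and> p $ i \<le> b)"
proof -
  obtain B where "\<And>p. p \<in> P \<Longrightarrow> norm p \<le> B"
    using finite_imp_bounded[OF assms] by (auto simp: bounded_iff)
  \<comment> \<open>The absolute value and the extra 1 ensure \<open>a < b\<close> even if
    \<open>B\<close> is negative or zero.\<close>
  then have "\<bar>p $ i\<bar> \<le> \<bar>B\<bar> + 1" if "p \<in> P" for p i
    using that component_le_norm_cart[of p i] by fastforce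
  then have "\<forall>p\<in>P. \<forall>i. - (\<bar>B\<bar> + 1) \<le> p $ i \<and> p $ i \<le> \<bar>B\<bar> + 1"
    by (auto simp: abs_le_iff) (smt (verit))+
  then show ?thesis by (intro exI[of _ "- (\<bar>B\<bar> + 1)"] exI[of _ "\<bar>B\<bar> + 1"]) auto
qed

text \<open>Probabilistic method: almost every output is a tree with \<open>card U\<close> leaves,
  so the constant \<open>expl_opt\<close> lies below the random cost almost surely and hence below
  its expectation.\<close>

lemma expl_opt_le_cost:
  fixes X U :: "(real^'d::finite) set"
  assumes X: "finite X" and U: "finite U" "U \<noteq> {}" and \<pi>: "\<And>x. x \<in> X \<Longrightarrow> \<pi> x \<in> U"
  shows "expl_opt (card U) X \<le> (1 + harm (card U - 1)) * cost1 X \<pi>"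
proof -
  obtain a b :: real where ab: "a < b" and box: "\<And>p i. p \<in> X \<union> U \<Longrightarrow> a \<le> p $ i \<and> p $ i \<le> b"
    using bounding_box[of "X \<union> U"] X U by auto
  interpret M: prob_space "cut_measure a b :: ('d \<times> real) measure" by (rule prob_space_cut_measure[OF ab])
  interpret sequence_space "cut_measure a b :: ('d \<times> real) measure" ..
  have S: "cut_seq_space a b = S" by (simp add: cut_seq_space_def)
  have sep: "AE w in S. \<exists>n. separates (rt_tree U w n) U"
    unfolding S[symmetric] by (rule AE_separates[OF ab U]) (simp add: box)
  have "AE w in S. ennreal (expl_opt (card U) X) \<le> ennreal (tree_cost1 X U (rt_output U w))"
    using sep
  proof eventually_elim
    case (elim w)
    then obtain m where "rt_output U w = rt_tree U w m" "separates (rt_tree U w m) U"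
      using rt_output_eq by blast
    then show ?case
      using expl_opt_le[OF separates_num_leaves[OF U(1)], of "rt_output U w" X] expl_cost_le_tree_cost1[OF X, of "rt_output U w" U]
      by (intro ennreal_leI) simp
  qed
  then have "(\<integral>\<^sup>+ w. ennreal (expl_opt (card U) X) \<partial>S) \<le> (\<integral>\<^sup>+ w. ennreal (tree_cost1 X U (rt_output U w)) \<partial>S)"
    by (rule nn_integral_mono_AE)
  also have "\<dots> \<le> ennreal ((1 + harm (card U - 1)) * cost1 X \<pi>)"
    using expected_tree_cost[OF X U \<pi> ab box] by (simp add: S)
  finally show ?thesis
    using cost1_nonneg[of X \<pi>] harm_nonneg[of "card U - 1", where 'a = real]
    by (simp add: P.emeasure_space_1 ennreal_le_iff)
qed

text \<open>For each set of \<open>k\<close> centres, assigning every point to a nearest one gives a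
  reference clustering; the bound then passes to the infimum after division by the positive
  factor.\<close>

lemma expl_opt_le_kmed_opt:
  fixes X :: "(real^'d::finite) set"
  assumes k: "1 \<le> k" and X: "finite X"
  shows "expl_opt k X \<le> (1 + harm (k - 1)) * kmed_opt k X"
proof -
  have pos: "0 < 1 + (harm (k - 1) :: real)" using harm_nonneg[of "k - 1", where 'a = real] by linarith
  have "expl_opt k X / (1 + harm (k - 1)) \<le> kmed_opt k X"
    unfolding kmed_opt_def
  proof (rule cINF_greatest)
    \<comment> \<open>The infimum must range over a nonempty family: an infinite space contains a
      set of exactly \<open>k\<close> centres.\<close>
    have "infinite (UNIV :: (real^'d) set)" by (rule infinite_UNIV_char_0)
    from infinite_arbitrarily_large[OF this, of k] show "{U :: (real^'d) set. finite U \<and> card U = k} \<noteq> {}"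
      by auto
  next
    fix U :: "(real^'d) set" assume "U \<in> {U. finite U \<and> card U = k}"
    then have U: "finite U" "card U = k" "U \<noteq> {}" using k by auto
    have "\<exists>u\<in>U. Min (l1dist x ` U) = l1dist x u" for x
      using Min_in[of "l1dist x ` U"] U by (metis finite_imageI image_is_empty image_iff)
    then obtain \<pi> where \<pi>: "\<And>x. \<pi> x \<in> U" "\<And>x. Min (l1dist x ` U) = l1dist x (\<pi> x)" by metis
    have "expl_opt k X \<le> (1 + harm (k - 1)) * cost1 X \<pi>"
      using expl_opt_le_cost[OF X U(1,3), of \<pi>] \<pi> U(2) by simp
    then show "expl_opt k X / (1 + harm (k - 1)) \<le> (\<Sum>x\<in>X. Min (l1dist x ` U))"
      using pos by (simp add: cost1_def \<pi>(2) field_simps)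
  qed
  with pos show ?thesis by (simp add: field_simps)
qed

theorem theorem1p1:
  fixes k :: nat
  assumes "k \<ge> 1"
  shows "(\<forall>(X :: (real^'d::finite) set) U \<pi> a b.
            finite X \<and> finite U \<and> card U = k \<and> (\<forall>x\<in>X. \<pi> x \<in> U) \<and>
            a < b \<and> (\<forall>p\<in>X \<union> U. \<forall>i. a \<le> p$i \<and> p$i \<le> b) \<longrightarrow>
            (AE w in cut_seq_space a b. separates (rt_output U w) U) \<and>
            (\<integral>\<^sup>+ w. ennreal (tree_cost1 X U (rt_output U w)) \<partial>cut_seq_space a b)
               \<le> ennreal ((1 + harm (k - 1)) * cost1 X \<pi>))
       \<and> (\<forall>X :: (real^'d) set. finite X \<longrightarrow>
            expl_opt k X \<le> (1 + harm (k - 1)) * kmed_opt k X)"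
proof (intro conjI allI impI; (elim conjE)?)
  fix X U :: "(real^'d) set" and \<pi> and a b :: real
  assume *: "finite X" "finite U" "card U = k" "\<forall>x\<in>X. \<pi> x \<in> U" "a < b"
    "\<forall>p\<in>X \<union> U. \<forall>i. a \<le> p$i \<and> p$i \<le> b"
  then have U: "U \<noteq> {}" using assms by auto
  have "AE w in cut_seq_space a b. \<exists>n. separates (rt_tree U w n) U"
    using * U by (intro AE_separates) auto
  then show "AE w in cut_seq_space a b. separates (rt_output U w) U"
    by eventually_elim (metis rt_output_eq)
  show "(\<integral>\<^sup>+ w. ennreal (tree_cost1 X U (rt_output U w)) \<partial>cut_seq_space a b)
      \<le> ennreal ((1 + harm (k - 1)) * cost1 X \<pi>)"
    using expected_tree_cost[of X U \<pi> a b] * U by auto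
qed (use expl_opt_le_kmed_opt assms in blast)

end
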